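(* The problem $\mathsf{WF}$ is Weihrauch incomparable with each of $\mathsf{OG\mapsto\alpha0}$, $\mathsf{OG\mapsto\alpha1}$ and $\mathsf{OG\mapsto\alpha}$; that is, for each $\mathsf{P}\in\{\mathsf{OG\mapsto\alpha0},\mathsf{OG\mapsto\alpha1},\mathsf{OG\mapsto\alpha}\}$, $\mathsf{WF}\not\leq_{\mathsf{W}}\mathsf{P}$ and $\mathsf{P}\not\leq_{\mathsf{W}}\mathsf{WF}$.
   Context: Weihrauch reducibility: a represented space is a set $X$ with a partial surjection $\delta_X:\subseteq\mathbb{N}^{\mathbb{N}}\to X$; if $\delta_X(p)=x$, $p$ is a name of $x$. A problem is a partial multi-valued function between represented spaces. $f\leq_{\mathsf{W}}g$ iff there are computable partial functions $\Phi,\Psi$ on Baire space such that whenever $p$ is a name of some $x\in\mathrm{dom}(f)$, $\Phi(p)$ is a name of some $z\in\mathrm{dom}(g)$, and for every name $q$ of an element of $g(z)$, $\Psi(p,q)$ is a name of an element of $f(x)$. Ordered groups: an ordered group is a group $G$ with a linear order $\leq$ such that $a\leq b$ implies $ag\leq bg$ and $ga\leq gb$ for all $g$. Countable ordered groups are presented on subsets of $\mathbb{N}$, a name coding the universe, operation and order. The order type of $G$ is a linear order $X$ such that there is an order-preserving bijection $G\to X$. For linear orders $X,Y$, the product $XY$ is $X\times Y$ with $\langle x_0,y_0\rangle<\langle x_1,y_1\rangle$ iff $y_0<y_1$, or $y_0=y_1$ and $x_0<x_1$. $\mathbb{Z}^X$ is the set of finitely supported functions $X\to\mathbb{Z}$,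 where for $f\neq g$, $f<g$ iff $f(x)<g(x)$ at the maximum $x$ where they differ. $\mathbb{Z}^\alpha\mathbb{Q}^0=\mathbb{Z}^\alpha$ and $\mathbb{Z}^\alpha\mathbb{Q}^1=\mathbb{Z}^\alpha\mathbb{Q}$. By Maltsev's theorem every countable ordered group has order type $\mathbb{Z}^\alpha\mathbb{Q}^\epsilon$ for some ordinal $\alpha$ and $\epsilon\in\{0,1\}$. A copy of an ordinal $\alpha$ is a pair $(A,<_A)$ with $A\subseteq\mathbb{N}$, $<_A\subseteq A\times A$ a well-order of $A$ isomorphic to $\alpha$, coded in Baire space. Problems: $\mathsf{OG\mapsto\alpha}$: given a countable ordered group $G$, output a copy of the $\alpha$ such that $G$ has order type $\mathbb{Z}^\alpha\mathbb{Q}^\epsilon$ for some $\epsilon\in\{0,1\}$. $\mathsf{OG\mapsto\alpha0}$ and $\mathsf{OG\mapsto\alpha1}$ are its restrictions to groups of order type $\mathbb{Z}^\alpha$ and of order type $\mathbb{Z}^\alpha\mathbb{Q}$ (for some $\alpha$), respectively. $\mathsf{WF}$: given a tree $T\subseteq\mathbb{N}^{<\mathbb{N}}$ (nonempty, closed under initial segments), output $0$ if $T$ is well-founded (no infinite path) and $1$ otherwise. *)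

theory Defs
  imports Complex_Main "HOL-Algebra.Group" "HOL-Library.Nat_Bijection" "HOL-Library.Sublist"
begin

section \<open>Computable partial functions on Baire space\<close>

type_synonym baire = "nat \<Rightarrow> nat"

datatype code =
    Zero_c | Succ_c | Proj_c nat | Query_c
  | Comp_c code "code list" | Prec_c code code | Min_c code

text \<open>
  Kleene's partial recursive functions relative to \<open>p\<close>:
  \<open>halts p e xs y\<close> says that the computation of \<open>e\<close> with \<open>Query_c\<close> answered by \<open>p\<close> on the
  arguments \<open>xs\<close> halts with value \<open>y\<close>.
\<close>

inductive halts :: "baire \<Rightarrow> code \<Rightarrow> nat list \<Rightarrow> nat \<Rightarrow> bool" for p :: baire where
  zero: "halts p Zero_c xs 0"
| succ: "halts p Succ_c [x] (Suc x)"
| proj: "i < length xs \<Longrightarrow> halts p (Proj_c i) xs (xs ! i)"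
| query: "halts p Query_c [x] (p x)"
| comp: "list_all2 (\<lambda>g y. halts p g xs y) gs ys \<Longrightarrow> halts p f ys z
    \<Longrightarrow> halts p (Comp_c f gs) xs z"
| prec_0: "halts p f xs y \<Longrightarrow> halts p (Prec_c f g) (0 # xs) y"
| prec_Suc: "halts p (Prec_c f g) (n # xs) y \<Longrightarrow> halts p g (n # y # xs) z
    \<Longrightarrow> halts p (Prec_c f g) (Suc n # xs) z"
| minim: "halts p f (n # xs) 0 \<Longrightarrow> (\<And>m. m < n \<Longrightarrow> \<exists>k. halts p f (m # xs) (Suc k))
    \<Longrightarrow> halts p (Min_c f) xs n"

lemma halts_det: "halts p e xs y \<Longrightarrow> halts p e xs z \<Longrightarrow> y = z"
proof (induction arbitrary: z rule: halts.induct)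
  case (zero xs)
  then show ?case by (cases rule: halts.cases) auto
next
  case (succ x)
  then show ?case by (cases rule: halts.cases) auto
next
  case (proj i xs)
  from proj.prems show ?case by (cases rule: halts.cases) auto
next
  case (query x)
  then show ?case by (cases rule: halts.cases) auto
next
  case (comp xs gs ys f y)
  from comp.prems obtain zs where zs: "list_all2 (\<lambda>g y. halts p g xs y) gs zs" "halts p f zs z"
    by (cases rule: halts.cases) blast
  have "ys = zs"
  proof (rule nth_equalityI)
    show "length ys = length zs"
      using comp.IH(1) zs(1) by (simp add: list_all2_conv_all_nth)
    show "ys ! i = zs ! i" if "i < length ys" for i
    proof -
      have i: "i < length gs" using comp.IH(1) that by (simp add: list_all2_conv_all_nth)
      have "halts p (gs ! i) xs (zs ! i)" using list_all2_nthD[OF zs(1) i] .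
      then show ?thesis using list_all2_nthD[OF comp.IH(1) i] by blast
    qed
  qed
  then show ?case using comp.IH(2) zs(2) by blast
next
  case (prec_0 f xs y g)
  from prec_0.prems have "halts p f xs z" by (cases rule: halts.cases) auto
  then show ?case by (rule prec_0.IH)
next
  case (prec_Suc f g n xs y w)
  from prec_Suc.prems obtain y' where y': "halts p (Prec_c f g) (n # xs) y'" "halts p g (n # y' # xs) z"
    by (cases rule: halts.cases) auto
  have "y = y'" using y'(1) by (rule prec_Suc.IH(1))
  then show ?case using y'(2) prec_Suc.IH(2) by blast
next
  case (minim f n xs)
  from minim.prems have z: "halts p f (z # xs) 0 \<and> (\<forall>m<z. \<exists>k. halts p f (m # xs) (Suc k))"
    by (cases rule: halts.cases) auto
  show ?case
  proof (cases n z rule: linorder_cases)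
    case less
    then obtain k where "halts p f (n # xs) (Suc k)" using z by blast
    then have "0 = Suc k" by (rule minim.IH(1))
    then show ?thesis by simp
  next
    case greater
    then obtain k where "\<And>y. halts p f (z # xs) y \<Longrightarrow> Suc k = y" using minim.IH(2) by blast
    then have "Suc k = 0" using z by blast
    then show ?thesis by simp
  qed
qed

text \<open>As usual, a program for \<open>F\<close> may also halt outside of the domain of \<open>F\<close>.\<close>

definition computable :: "(baire \<rightharpoonup> baire) \<Rightarrow> bool" where
  "computable F \<longleftrightarrow> (\<exists>e. \<forall>p q. F p = Some q \<longrightarrow> (\<forall>n. halts p e [n] (q n)))"

definition baire_pair :: "baire \<Rightarrow> baire \<Rightarrow> baire" where
  "baire_pair p q = (\<lambda>n. if even n then p (n div 2) else q (n div 2))"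

definition baire_fst :: "baire \<Rightarrow> baire" where
  "baire_fst p = (\<lambda>n. p (2 * n))"

definition baire_snd :: "baire \<Rightarrow> baire" where
  "baire_snd p = (\<lambda>n. p (2 * n + 1))"

lemma baire_fst_pair [simp]: "baire_fst (baire_pair p q) = p"
  and baire_snd_pair [simp]: "baire_snd (baire_pair p q) = q"
  by (auto simp: baire_fst_def baire_snd_def baire_pair_def)

section \<open>Represented spaces, problems and Weihrauch reducibility\<close>

text \<open>A represented space is given by its representation \<open>\<delta>\<close>; its set of points is \<open>ran \<delta>\<close>.\<close>

type_synonym 'a repr = "baire \<rightharpoonup> 'a"

record ('a, 'b) problem =
  inrep :: "'a repr"
  outrep :: "'b repr"
  sol :: "'a \<Rightarrow> 'b set"

definition pdom :: "('a, 'b) problem \<Rightarrow> 'a set" where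
  "pdom f = {x \<in> ran (inrep f). sol f x \<noteq> {}}"

definition restrict_problem :: "('a, 'b) problem \<Rightarrow> 'a set \<Rightarrow> ('a, 'b) problem" where
  "restrict_problem f D = f\<lparr>sol := (\<lambda>x. if x \<in> D then sol f x else {})\<rparr>"

definition weihrauch_le :: "('a, 'b) problem \<Rightarrow> ('c, 'd) problem \<Rightarrow> bool" (infix \<open>\<le>\<^sub>W\<close> 50) where
  "f \<le>\<^sub>W g \<longleftrightarrow> (\<exists>\<Phi> \<Psi>. computable \<Phi> \<and> computable \<Psi> \<and>
     (\<forall>p x. inrep f p = Some x \<and> x \<in> pdom f \<longrightarrow>
       (\<exists>p' z. \<Phi> p = Some p' \<and> inrep g p' = Some z \<and> z \<in> pdom g \<and>
         (\<forall>q y. outrep g q = Some y \<and> y \<in> sol g z \<longrightarrow>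
           (\<exists>r w. \<Psi> (baire_pair p q) = Some r \<and> outrep f r = Some w \<and> w \<in> sol f x)))))"

section \<open>Linear orders\<close>

text \<open>
  Linear orders are reflexive relations, with the field as underlying set (so the empty
  relation is the empty order). Ordinals are well-orders up to isomorphism, compared with
  \<open>ordIso\<close>.
\<close>

definition order_isomorphic :: "'a rel \<Rightarrow> 'b rel \<Rightarrow> bool" where
  "order_isomorphic r s \<longleftrightarrow> (\<exists>f. bij_betw f (Field r) (Field s) \<and>
     (\<forall>x\<in>Field r. \<forall>y\<in>Field r. (x, y) \<in> r \<longleftrightarrow> (f x, f y) \<in> s))"

text \<open>The product is ordered by the second coordinate first.\<close>

definition order_prod :: "'a rel \<Rightarrow> 'b rel \<Rightarrow> ('a \<times> 'b) rel" where
  "order_prod r s = {((x0, y0), (x1, y1)).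
     x0 \<in> Field r \<and> x1 \<in> Field r \<and> y0 \<in> Field s \<and> y1 \<in> Field s \<and>
     ((y0, y1) \<in> s \<and> y0 \<noteq> y1 \<or> y0 = y1 \<and> (x0, x1) \<in> r)}"

definition fin_supp :: "'a set \<Rightarrow> ('a \<Rightarrow> int) set" where
  "fin_supp X = {f. finite {x. f x \<noteq> 0} \<and> {x. f x \<noteq> 0} \<subseteq> X}"

definition Z_power :: "'a rel \<Rightarrow> ('a \<Rightarrow> int) rel" where
  "Z_power r = {(f, g). f \<in> fin_supp (Field r) \<and> g \<in> fin_supp (Field r) \<and>
     (f = g \<or>
      (\<exists>x\<in>Field r. f x < g x \<and> (\<forall>y\<in>Field r. f y \<noteq> g y \<longrightarrow> (y, x) \<in> r)))}"

definition Q_order :: "rat rel" where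
  "Q_order = {(x, y). x \<le> y}"

text \<open>
  \<open>has_type_ZQ r \<alpha> \<epsilon>\<close>: the order \<open>r\<close> is isomorphic to \<open>\<int>\<^sup>\<alpha>\<rat>\<^sup>\<epsilon>\<close>.
\<close>

definition has_type_ZQ :: "'a rel \<Rightarrow> 'b rel \<Rightarrow> nat \<Rightarrow> bool" where
  "has_type_ZQ r \<alpha> \<epsilon> \<longleftrightarrow>
     (\<epsilon> = 0 \<and> order_isomorphic r (Z_power \<alpha>)) \<or>
     (\<epsilon> = 1 \<and> order_isomorphic r (order_prod (Z_power \<alpha>) Q_order))"

text \<open>In a copy \<open>(A, R)\<close> of an ordinal, \<open>R\<close> is the strict order on \<open>A\<close>.\<close>

definition ordinal_copy :: "'b rel \<Rightarrow> nat set \<times> nat rel \<Rightarrow> bool" where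
  "ordinal_copy \<alpha> = (\<lambda>(A, R). R \<subseteq> A \<times> A \<and> irrefl R \<and> (R \<union> Id_on A, \<alpha>) \<in> ordIso)"

section \<open>Ordered groups\<close>

record 'a ogroup = "'a monoid" +
  le_rel :: "'a rel"

locale ordered_group = group G for G :: "('a, 'b) ogroup_scheme" (structure) +
  assumes le_linear: "linear_order_on (carrier G) (le_rel G)"
    and le_mult_right: "\<lbrakk>a \<in> carrier G; b \<in> carrier G; g \<in> carrier G; (a, b) \<in> le_rel G\<rbrakk>
      \<Longrightarrow> (a \<otimes> g, b \<otimes> g) \<in> le_rel G"
    and le_mult_left: "\<lbrakk>a \<in> carrier G; b \<in> carrier G; g \<in> carrier G; (a, b) \<in> le_rel G\<rbrakk>
      \<Longrightarrow> (g \<otimes> a, g \<otimes> b) \<in> le_rel G"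

section \<open>Representations\<close>

text \<open>
  Sets are coded by characteristic functions; every value other than 1 is read as
  non-membership, so that decoding is total.
\<close>

definition set_of_name :: "baire \<Rightarrow> nat set" where
  "set_of_name p = {n. p n = 1}"

definition rel_of_name :: "baire \<Rightarrow> nat rel" where
  "rel_of_name p = {(a, b). prod_encode (a, b) \<in> set_of_name p}"

text \<open>
  The name of an ordered group codes universe, operation and order. The operation is set
  to 0 off the universe, so that the decoded structure depends on nothing else.
\<close>

definition ogroup_of_name :: "baire \<Rightarrow> nat ogroup" where
  "ogroup_of_name p =
    (let A = set_of_name (baire_fst p);
         m = (\<lambda>a b. if a \<in> A \<and> b \<in> A then baire_fst (baire_snd p) (prod_encode (a, b)) else 0)
     in \<lparr>carrier = A, mult = m, one = (THE e. e \<in> A \<and> (\<forall>a\<in>A. m e a = a \<and> m a e = a)),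
         le_rel = rel_of_name (baire_snd (baire_snd p))\<rparr>)"

definition ogroup_rep :: "nat ogroup repr" where
  "ogroup_rep p = (if ordered_group (ogroup_of_name p) then Some (ogroup_of_name p) else None)"

definition copy_of_name :: "baire \<Rightarrow> nat set \<times> nat rel" where
  "copy_of_name p = (set_of_name (baire_fst p), rel_of_name (baire_snd p))"

definition copy_rep :: "(nat set \<times> nat rel) repr" where
  "copy_rep p = (if \<exists>\<alpha> :: nat rel. ordinal_copy \<alpha> (copy_of_name p)
     then Some (copy_of_name p) else None)"

definition is_tree :: "nat list set \<Rightarrow> bool" where
  "is_tree T \<longleftrightarrow> T \<noteq> {} \<and> (\<forall>s\<in>T. \<forall>t. prefix t s \<longrightarrow> t \<in> T)"

definition tree_of_name :: "baire \<Rightarrow> nat list set" where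
  "tree_of_name p = {s. list_encode s \<in> set_of_name p}"

definition tree_rep :: "nat list set repr" where
  "tree_rep p = (if is_tree (tree_of_name p) then Some (tree_of_name p) else None)"

definition nat_rep :: "nat repr" where
  "nat_rep p = Some (p 0)"

section \<open>The problems\<close>

definition well_founded_tree :: "nat list set \<Rightarrow> bool" where
  "well_founded_tree T \<longleftrightarrow> \<not> (\<exists>f :: nat \<Rightarrow> nat. \<forall>n. map f [0..<n] \<in> T)"

definition WF :: "(nat list set, nat) problem" where
  "WF = \<lparr>inrep = tree_rep, outrep = nat_rep,
         sol = (\<lambda>T. {if well_founded_tree T then 0 else 1})\<rparr>"

text \<open>
  The exponents \<open>\<alpha>\<close> can be taken on subsets of \<open>nat\<close> because the groups are countable. By
  Maltsev's theorem, \<open>OG_alpha\<close> is defined on all ordered groups on subsets of \<open>nat\<close>.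
\<close>

definition OG_alpha :: "(nat ogroup, nat set \<times> nat rel) problem" where
  "OG_alpha = \<lparr>inrep = ogroup_rep, outrep = copy_rep,
     sol = (\<lambda>G. {C. \<exists>(\<alpha> :: nat rel) \<epsilon>. Well_order \<alpha> \<and> \<epsilon> \<in> {0, 1} \<and>
                     has_type_ZQ (le_rel G) \<alpha> \<epsilon> \<and> ordinal_copy \<alpha> C})\<rparr>"

definition OG_alpha0 :: "(nat ogroup, nat set \<times> nat rel) problem" where
  "OG_alpha0 = restrict_problem OG_alpha
     {G. \<exists>\<alpha> :: nat rel. Well_order \<alpha> \<and> has_type_ZQ (le_rel G) \<alpha> 0}"

definition OG_alpha1 :: "(nat ogroup, nat set \<times> nat rel) problem" where
  "OG_alpha1 = restrict_problem OG_alpha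
     {G. \<exists>\<alpha> :: nat rel. Well_order \<alpha> \<and> has_type_ZQ (le_rel G) \<alpha> 1}"

end

theory Submission
  imports Defs "HOL-Library.Function_Algebras" "HOL-Library.Product_Plus" "HOL-Library.Countable_Set"
begin

text \<open>
  Both non-reductions are topological: a computable functional reads only finitely much of its
  input to determine a value of its output.

  \<open>WF \<le>\<^sub>W P\<close> fails because copies of ordinals can be exchanged. Among all trees choose one for which
  the ordinal \<open>\<alpha>\<close> answering the associated instance of \<open>P\<close> is least. The backward functional decides
  this tree from finitely much of the tree and of a copy of \<open>\<alpha>\<close>. Every other tree with the same finite
  part has an ordinal \<open>\<beta> \<ge> \<alpha>\<close>, which has a copy that agrees with the finite part read of the copy of
  \<open>\<alpha>\<close>, so it gets the same verdict. But the finite part extends to trees of both kinds.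

  \<open>P \<le>\<^sub>W WF\<close> fails because \<open>WF\<close> answers only a bit \<open>b\<close>. For the groups \<open>\<int>\<^sup>3\<rat>\<^sup>\<epsilon>\<close>, \<open>\<int>\<^sup>2\<rat>\<^sup>\<epsilon>\<close> and \<open>\<int>\<rat>\<^sup>\<epsilon>\<close> the
  correct bit produces a copy of 3, 2 and 1. Every finite part of a name of \<open>\<int>\<^sup>n\<^sup>+\<^sup>1\<rat>\<^sup>\<epsilon>\<close> extends to a name of
  \<open>\<int>\<^sup>n\<rat>\<^sup>\<epsilon>\<close>, so three names can be chosen such that each agrees with its predecessors beyond the point
  where their copies are enumerated. Two of the three bits coincide, and the smaller group then
  receives a copy with too many elements. That the exponent is determined by the order type is seen
  by counting how often the finite condensation properly coarsens the order.
\<close>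

section \<open>Continuity of computable functionals on Baire space\<close>

text \<open>A halting computation is a finitely branching derivation, so it asks finitely many
  queries. At each rule the bounds of the finitely many premises are added; for \<open>Min_c\<close>
  the premises are the test at \<open>n\<close> and the failed tests below \<open>n\<close>.\<close>

lemma halts_finite_use:
  "halts p e xs y \<Longrightarrow> \<exists>N. \<forall>p'. (\<forall>n<N. p' n = p n) \<longrightarrow> halts p' e xs y"
proof (induction rule: halts.induct)
  case (comp xs gs ys f z)
  define U where "U g y N \<longleftrightarrow> (\<forall>p'. (\<forall>n<N. p' n = p n) \<longrightarrow> halts p' g xs y)" for g y N
  have len: "length gs = length ys"
    using comp.IH(1) by (simp add: list_all2_lengthD)
  have "\<forall>i\<in>{..<length gs}. \<exists>N. U (gs ! i) (ys ! i) N"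
    using comp.IH(1) by (auto simp: list_all2_conv_all_nth U_def)
  then obtain N where N: "\<And>i. i < length gs \<Longrightarrow> U (gs ! i) (ys ! i) (N i)"
    by (metis lessThan_iff)
  obtain N' where N': "\<forall>p'. (\<forall>n<N'. p' n = p n) \<longrightarrow> halts p' f ys z"
    using comp.IH(2) by blast
  have "halts p' (Comp_c f gs) xs z"
    if agree: "\<forall>n < N' + sum N {..<length gs}. p' n = p n" for p'
  proof (rule halts.comp)
    show "halts p' f ys z" using N' agree by simp
    have "halts p' (gs ! i) xs (ys ! i)" if "i < length gs" for i
    proof -
      have "N i \<le> sum N {..<length gs}"
        using that by (intro member_le_sum) auto
      then show ?thesis using N[OF that] agree by (simp add: U_def)
    qed
    then show "list_all2 (\<lambda>g y. halts p' g xs y) gs ys"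
      using len by (simp add: list_all2_conv_all_nth)
  qed
  then show ?case by blast
next
  case (prec_0 f xs y g)
  then show ?case by (meson halts.prec_0)
next
  case (prec_Suc f g n xs y z)
  then obtain N N' where "\<forall>p'. (\<forall>n<N. p' n = p n) \<longrightarrow> halts p' (Prec_c f g) (n # xs) y"
    "\<forall>p'. (\<forall>n<N'. p' n = p n) \<longrightarrow> halts p' g (n # y # xs) z" by blast
  then have "\<forall>p'. (\<forall>n<N + N'. p' n = p n) \<longrightarrow> halts p' (Prec_c f g) (Suc n # xs) z"
    by (metis halts.prec_Suc trans_less_add1 trans_less_add2)
  then show ?case by blast
next
  case (minim f n xs)
  define U where "U m k N \<longleftrightarrow> (\<forall>p'. (\<forall>n<N. p' n = p n) \<longrightarrow> halts p' f (m # xs) k)" for m k N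
  have "\<forall>m\<in>{..<n}. \<exists>N. \<exists>k. U m (Suc k) N"
    using minim.IH(2) by (auto simp: U_def) blast
  then obtain N where N: "\<And>m. m < n \<Longrightarrow> \<exists>k. U m (Suc k) (N m)"
    by (metis lessThan_iff)
  obtain N' where N': "\<forall>p'. (\<forall>i<N'. p' i = p i) \<longrightarrow> halts p' f (n # xs) 0"
    using minim.IH(1) by blast
  have "halts p' (Min_c f) xs n"
    if agree: "\<forall>i < N' + sum N {..<n}. p' i = p i" for p'
  proof (rule halts.minim)
    show "halts p' f (n # xs) 0" using N' agree by simp
    show "\<exists>k. halts p' f (m # xs) (Suc k)" if "m < n" for m
    proof -
      have "N m \<le> sum N {..<n}"
        using that by (intro member_le_sum) auto
      then have "\<forall>i<N m. p' i = p i" using agree by simp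
      moreover obtain k where "U m (Suc k) (N m)" using N[OF \<open>m < n\<close>] ..
      ultimately show ?thesis unfolding U_def by blast
    qed
  qed
  then show ?case by blast
next
  case (query x)
  have "\<forall>p'. (\<forall>n<Suc x. p' n = p n) \<longrightarrow> halts p' Query_c [x] (p x)"
    by (metis halts.query lessI)
  then show ?case by blast
qed (auto intro: halts.intros)

text \<open>One program serves all inputs, and \<open>halts_det\<close> forces its value. Since the
  program may also halt outside the domain of \<open>F\<close>, the conclusion speaks only of inputs
  on which \<open>F\<close> is defined.\<close>

lemma computable_continuous:
  assumes "computable F" and "F p = Some r"
  shows "\<exists>N. \<forall>p' r'. (\<forall>n<N. p' n = p n) \<longrightarrow> F p' = Some r' \<longrightarrow> r' i = r i"
proof -
  obtain e where e: "\<And>p q n. F p = Some q \<Longrightarrow> halts p e [n] (q n)"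
    using assms(1) unfolding computable_def by blast
  obtain N where N: "\<forall>p'. (\<forall>n<N. p' n = p n) \<longrightarrow> halts p' e [i] (r i)"
    using halts_finite_use[OF e[OF assms(2)]] by metis
  show ?thesis
  proof (intro exI[of _ N] allI impI)
    fix p' r'
    assume "\<forall>n<N. p' n = p n" "F p' = Some r'"
    then show "r' i = r i"
      using N e[of p' r' i] halts_det by metis
  qed
qed

lemma baire_pair_agree:
  assumes "\<forall>n<N. p n = p' n" "\<forall>n<N. q n = q' n"
  shows "\<forall>n<N. baire_pair p q n = baire_pair p' q' n"
  using assms by (auto simp: baire_pair_def)

lemma computable_pair_continuous:
  assumes "computable F" and "F (baire_pair p q) = Some r"
  shows "\<exists>N. \<forall>p' q' r'. (\<forall>n<N. p' n = p n) \<longrightarrow> (\<forall>n<N. q' n = q n) \<longrightarrow>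
    F (baire_pair p' q') = Some r' \<longrightarrow> r' i = r i"
proof -
  obtain N where N: "\<forall>p' r'. (\<forall>n<N. p' n = baire_pair p q n) \<longrightarrow> F p' = Some r' \<longrightarrow> r' i = r i"
    using computable_continuous[of F "baire_pair p q" r i] assms by metis
  show ?thesis
  proof (intro exI[of _ N] allI impI)
    fix p' q' r'
    assume "\<forall>n<N. p' n = p n" "\<forall>n<N. q' n = q n" "F (baire_pair p' q') = Some r'"
    then show "r' i = r i"
      using N baire_pair_agree[of N p' p q' q] by simp
  qed
qed

section \<open>Copies of ordinals\<close>

lemma ordinal_copy_strict:
  assumes "Well_order \<alpha>"
  shows "ordinal_copy \<alpha> (Field \<alpha>, \<alpha> - Id)"
proof -
  have "refl_on (Field \<alpha>) \<alpha>"
    using assms by (simp add: order_on_defs)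
  then have "\<alpha> - Id \<union> Id_on (Field \<alpha>) = \<alpha>"
    by (auto simp: refl_on_def Field_def)
  then show ?thesis
    using assms by (auto simp: ordinal_copy_def irrefl_def Field_def intro: ordIso_reflexive)
qed

lemma ordinal_copy_dir_image:
  assumes "Well_order \<alpha>" "inj_on g (Field \<alpha>)"
  shows "ordinal_copy \<alpha> (g ` Field \<alpha>, dir_image \<alpha> g - Id)"
proof -
  have wo: "Well_order (dir_image \<alpha> g)"
    using assms by (rule Well_order_dir_image)
  have "(dir_image \<alpha> g, \<alpha>) \<in> ordIso"
    using assms by (simp add: dir_image_ordIso ordIso_symmetric)
  then show ?thesis
    using ordinal_copy_strict[OF wo] ordIso_transitive
    by (auto simp: ordinal_copy_def dir_image_Field)
qed

lemma ordinal_copy_bij: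
  assumes "ordinal_copy \<alpha> (A, R)"
  shows "\<exists>f. bij_betw f A (Field \<alpha>)"
proof -
  have iso: "(R \<union> Id_on A, \<alpha>) \<in> ordIso" and R: "R \<subseteq> A \<times> A"
    using assms by (auto simp: ordinal_copy_def)
  have "Field (R \<union> Id_on A) = A"
    using R by (auto simp: Field_def)
  then show ?thesis
    using iso by (auto simp: ordIso_def BNF_Wellorder_Embedding.iso_def simp del: Field_Un)
qed

definition copy_name :: "nat set \<times> nat rel \<Rightarrow> baire" where
  "copy_name = (\<lambda>(A, R). baire_pair (\<lambda>n. of_bool (n \<in> A)) (\<lambda>n. of_bool (prod_decode n \<in> R)))"

lemma copy_of_name_copy_name [simp]: "copy_of_name (copy_name C) = C"
  by (cases C) (auto simp: copy_of_name_def copy_name_def set_of_name_def rel_of_name_def)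

lemma copy_rep_copy_name: "ordinal_copy (\<alpha> :: nat rel) C \<Longrightarrow> copy_rep (copy_name C) = Some C"
  by (auto simp: copy_rep_def)

text \<open>Both components of a pair are at most its code, so the bits below \<open>N\<close>
  concern only elements and pairs of elements below \<open>N\<close>.\<close>

lemma copy_name_agree:
  assumes "\<And>a. a < N \<Longrightarrow> a \<in> A' \<longleftrightarrow> a \<in> A"
    and "\<And>a b. a < N \<Longrightarrow> b < N \<Longrightarrow> (a, b) \<in> R' \<longleftrightarrow> (a, b) \<in> R"
  shows "\<forall>n<N. copy_name (A', R') n = copy_name (A, R) n"
proof -
  have "prod_decode n \<in> R' \<longleftrightarrow> prod_decode n \<in> R" if "n < N" for n
  proof -
    obtain a b where ab: "prod_decode n = (a, b)" by force
    then have "n = prod_encode (a, b)" by (metis prod_decode_inverse)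
    then have "a < N" "b < N"
      using le_prod_encode_1[of a b] le_prod_encode_2[of b a] that by auto
    then show ?thesis using assms(2) ab by simp
  qed
  then have "\<forall>n<N. of_bool (prod_decode n \<in> R') = (of_bool (prod_decode n \<in> R) :: nat)"
    by simp
  moreover have "\<forall>n<N. of_bool (n \<in> A') = (of_bool (n \<in> A) :: nat)"
    using assms(1) by simp
  ultimately show ?thesis
    unfolding copy_name_def case_prod_conv by (rule baire_pair_agree[rotated])
qed

text \<open>Embed \<alpha> into \<beta> and relabel \<beta>: the images of elements below
  \<open>N\<close> receive their old labels, and everything else receives a label of at least
  \<open>N\<close>, where the prefix cannot see it.\<close>

lemma copy_extends_to_larger_ordinal:
  fixes \<alpha> \<beta> :: "nat rel"
  assumes le: "(\<alpha>, \<beta>) \<in> ordLeq"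
  shows "\<exists>C. ordinal_copy \<beta> C \<and> (\<forall>n<N. copy_name C n = copy_name (Field \<alpha>, \<alpha> - Id) n)"
proof -
  have wo: "Well_order \<alpha>" "Well_order \<beta>"
    using le by (auto simp: ordLeq_def)
  obtain f where f: "embed \<alpha> \<beta> f"
    using le by (auto simp: ordLeq_def)
  interpret wo_rel \<alpha> using wo(1) by (simp add: wo_rel_def)
  have inj: "inj_on f (Field \<alpha>)"
    using embed_inj_on[OF wo(1) f] .
  have fF: "f a \<in> Field \<beta>" if "a \<in> Field \<alpha>" for a
    using embed_Field[OF f] that by blast
  have compat: "(f a, f b) \<in> \<beta>" if "(a, b) \<in> \<alpha>" for a b
    using embed_compat[OF f] that by (auto simp: compat_def)
  have "antisym \<beta>"
    using wo(2) by (auto simp: order_on_defs)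
  then have f_iff: "(f a, f b) \<in> \<beta> \<longleftrightarrow> (a, b) \<in> \<alpha>" if "a \<in> Field \<alpha>" "b \<in> Field \<alpha>" for a b
    using that compat inj TOTALS by (metis antisymD inj_on_eq_iff)
  define B where "B = Field \<alpha> \<inter> {..<N}"
  have Bsub: "B \<subseteq> Field \<alpha>" by (auto simp: B_def)
  \<comment> \<open>Adding \<open>N\<close> keeps the remaining labels distinct and apart from those
    of \<open>B\<close>, which are below \<open>N\<close>.\<close>
  define g where "g y = (if y \<in> f ` B then inv_into B f y else N + y)" for y
  have injB: "inj_on f B" using inj Bsub by (rule inj_on_subset)
  have gf: "g (f a) = a" if "a \<in> B" for a
    using that injB by (simp add: g_def)
  have g_lt: "y \<in> f ` B" if "g y < N" for y
    using that by (auto simp: g_def split: if_splits)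
  have g_inj: "inj g"
  proof (rule injI)
    fix x y assume eq: "g x = g y"
    consider "x \<in> f ` B" "y \<in> f ` B" | "x \<notin> f ` B" "y \<notin> f ` B"
      using eq g_lt gf by (metis B_def Int_iff imageE lessThan_iff)
    then show "x = y"
      using eq gf by cases (auto simp: g_def)
  qed
  define C where "C = (g ` Field \<beta>, dir_image \<beta> g - Id)"
  have "ordinal_copy \<beta> C"
    unfolding C_def by (rule ordinal_copy_dir_image) (use wo g_inj inj_on_subset in auto)
  moreover have "\<forall>n<N. copy_name C n = copy_name (Field \<alpha>, \<alpha> - Id) n"
    unfolding C_def
  proof (rule copy_name_agree)
    fix a assume "a < N"
    then have "a \<in> B" if "a \<in> Field \<alpha>"
      using that by (simp add: B_def)
    moreover have "a \<in> B" if "a \<in> g ` Field \<beta>"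
      using that g_lt gf \<open>a < N\<close> by fastforce
    ultimately show "a \<in> g ` Field \<beta> \<longleftrightarrow> a \<in> Field \<alpha>"
      using gf fF Bsub by (metis imageI subsetD)
  next
    fix a b assume ab: "a < N" "b < N"
    show "(a, b) \<in> dir_image \<beta> g - Id \<longleftrightarrow> (a, b) \<in> \<alpha> - Id"
    proof
      assume "(a, b) \<in> dir_image \<beta> g - Id"
      then obtain x y where xy: "(x, y) \<in> \<beta>" "a = g x" "b = g y" "a \<noteq> b"
        by (auto simp: dir_image_def)
      then obtain c d where cd: "c \<in> B" "x = f c" "d \<in> B" "y = f d"
        using g_lt ab by blast
      then have "c \<in> Field \<alpha>" "d \<in> Field \<alpha>" using Bsub by auto
      then show "(a, b) \<in> \<alpha> - Id" using xy cd gf f_iff by auto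
    next
      assume *: "(a, b) \<in> \<alpha> - Id"
      then have "a \<in> B" "b \<in> B" using ab by (auto simp: B_def Field_def)
      moreover have "(g (f a), g (f b)) \<in> dir_image \<beta> g"
        using * compat unfolding dir_image_def by blast
      ultimately show "(a, b) \<in> dir_image \<beta> g - Id"
        using * gf by simp
    qed
  qed
  ultimately show ?thesis by blast
qed

section \<open>\<open>WF\<close> is not reducible to computing an ordinal\<close>

lemma triangle_mono: "m \<le> n \<Longrightarrow> triangle m \<le> triangle n"
  by (induction rule: dec_induct) auto

text \<open>Consequently the nodes of a tree whose codes lie below a fixed bound again form a set
  closed under initial segments.\<close>

lemma list_encode_prefix_le: "prefix s t \<Longrightarrow> list_encode s \<le> list_encode t"
proof (induction s arbitrary: t)
  case (Cons x s)
  then obtain t' where t: "t = x # t'" "prefix s t'" by (cases t) auto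
  then have "list_encode s \<le> list_encode t'" using Cons.IH by blast
  then show ?case using t by (simp add: prod_encode_def triangle_mono)
qed simp

text \<open>The first \<open>N\<close> entries decide only nodes with code below \<open>N\<close>.
  Keeping just those gives a finite tree; adding one path that leaves this range right after the
  root gives an ill-founded one. Positivity of \<open>N\<close> ensures that the root, whose code is
  0, is among the decided nodes.\<close>

lemma tree_prefix_extensions:
  assumes "is_tree (tree_of_name p)" and "0 < N"
  shows "\<exists>p'. is_tree (tree_of_name p') \<and> well_founded_tree (tree_of_name p') \<and> (\<forall>n<N. p' n = p n)"
    and "\<exists>p'. is_tree (tree_of_name p') \<and> \<not> well_founded_tree (tree_of_name p') \<and> (\<forall>n<N. p' n = p n)"
proof -
  let ?T = "tree_of_name p"
  have nil: "[] \<in> ?T"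
    using assms(1) by (auto simp: is_tree_def)
  have closed: "t \<in> ?T" if "s \<in> ?T" "prefix t s" for s t
    using assms(1) that by (auto simp: is_tree_def)
  have code0: "list_encode [] < N" using assms(2) by simp
  define p0 where "p0 n = (if n < N then p n else 0)" for n
  have T0: "tree_of_name p0 = {s \<in> ?T. list_encode s < N}"
    by (auto simp: tree_of_name_def set_of_name_def p0_def)
  have "is_tree (tree_of_name p0)"
    unfolding is_tree_def T0 using nil code0 closed list_encode_prefix_le le_less_trans by blast
  moreover have "finite (tree_of_name p0)"
  proof (rule finite_subset)
    show "tree_of_name p0 \<subseteq> list_decode ` {..<N}"
      by (auto simp: T0 image_iff) (metis lessThan_iff list_encode_inverse)
  qed simp
  have "well_founded_tree (tree_of_name p0)"
    unfolding well_founded_tree_def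
  proof
    assume "\<exists>f. \<forall>n. map f [0..<n] \<in> tree_of_name p0"
    then obtain f where f: "range (\<lambda>n. map f [0..<n]) \<subseteq> tree_of_name p0" by blast
    have "inj (\<lambda>n. map f [0..<n])"
      by (rule injI) (metis diff_zero length_map length_upt)
    then show False
      using \<open>finite (tree_of_name p0)\<close> f finite_subset finite_imageD infinite_UNIV_nat by blast
  qed
  ultimately show "\<exists>p'. is_tree (tree_of_name p') \<and> well_founded_tree (tree_of_name p') \<and> (\<forall>n<N. p' n = p n)"
    by (intro exI[of _ p0]) (simp add: p0_def)
  \<comment> \<open>the constant path with value \<open>N\<close> has no codes below \<open>N\<close> except that of the root\<close>
  define p1 where "p1 n = (if n < N then p n else of_bool (\<exists>k. list_decode n = replicate k N))" for n
  have big: "N \<le> list_encode (replicate k N)" if "k > 0" for k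
    using that le_prod_encode_1 by (cases k) (auto simp: le_SucI)
  have T1: "tree_of_name p1 = {s \<in> ?T. list_encode s < N} \<union> range (\<lambda>k. replicate k N)"
  proof (intro equalityI subsetI)
    fix s assume "s \<in> tree_of_name p1"
    then show "s \<in> {s \<in> ?T. list_encode s < N} \<union> range (\<lambda>k. replicate k N)"
      by (cases "list_encode s < N") (auto simp: tree_of_name_def set_of_name_def p1_def image_iff of_bool_def split: if_splits)
  next
    fix s assume "s \<in> {s \<in> ?T. list_encode s < N} \<union> range (\<lambda>k. replicate k N)"
    moreover have rep: "replicate k N \<in> tree_of_name p1" for k
      using nil code0 big[of k] by (cases "k = 0") (auto simp: tree_of_name_def set_of_name_def p1_def)
    ultimately show "s \<in> tree_of_name p1"
      using rep by (elim UnE rangeE) (auto simp: tree_of_name_def set_of_name_def p1_def)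
  qed
  have pre_rep: "\<exists>j. t = replicate j N" if "prefix t (replicate k N)" for t k
  proof -
    have "set t \<subseteq> {N}"
      using set_mono_prefix[OF that] by (auto split: if_splits)
    then have "t = replicate (length t) N" by (intro replicate_eqI) auto
    then show ?thesis ..
  qed
  have "is_tree (tree_of_name p1)"
    unfolding is_tree_def
  proof (intro conjI ballI allI impI)
    show "tree_of_name p1 \<noteq> {}" by (auto simp: T1)
    fix s t assume "s \<in> tree_of_name p1" and t: "prefix t s"
    then consider "s \<in> ?T" "list_encode s < N" | k where "s = replicate k N"
      by (auto simp: T1)
    then show "t \<in> tree_of_name p1"
    proof cases
      case 1
      then have "t \<in> ?T" "list_encode t < N"
        using t closed list_encode_prefix_le[OF t] by auto
      then show ?thesis by (simp add: T1)
    next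
      case 2
      then show ?thesis using t pre_rep by (auto simp: T1)
    qed
  qed
  moreover have "\<not> well_founded_tree (tree_of_name p1)"
    unfolding well_founded_tree_def T1
    by (auto intro!: exI[of _ "\<lambda>_. N"] simp: map_replicate_const)
  ultimately show "\<exists>p'. is_tree (tree_of_name p') \<and> \<not> well_founded_tree (tree_of_name p') \<and> (\<forall>n<N. p' n = p n)"
    by (intro exI[of _ p1]) (simp add: p1_def)
qed

text \<open>The relation \<open>S\<close> leaves open how an instance determines its ordinals. What
  counts is that with one copy of an ordinal all its copies are solutions, so the backward
  functional has to cope with a copy chosen adversarially.\<close>

lemma WF_not_le_ordinal_problem:
  fixes P :: "('a, nat set \<times> nat rel) problem"
  assumes out: "outrep P = copy_rep"
    and sol: "\<And>z. sol P z = {C. \<exists>\<alpha> :: nat rel. Well_order \<alpha> \<and> S z \<alpha> \<and> ordinal_copy \<alpha> C}"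
  shows "\<not> WF \<le>\<^sub>W P"
proof
  assume "WF \<le>\<^sub>W P"
  then obtain \<Phi> \<Psi> where \<Psi>: "computable \<Psi>" and red:
    "\<And>p x. inrep WF p = Some x \<Longrightarrow> x \<in> pdom WF \<Longrightarrow>
       \<exists>p' z. \<Phi> p = Some p' \<and> inrep P p' = Some z \<and> z \<in> pdom P \<and>
         (\<forall>q y. outrep P q = Some y \<and> y \<in> sol P z \<longrightarrow>
           (\<exists>r w. \<Psi> (baire_pair p q) = Some r \<and> outrep WF r = Some w \<and> w \<in> sol WF x))"
    unfolding weihrauch_le_def by blast
  define bit where "bit p = (if well_founded_tree (tree_of_name p) then 0 else 1 :: nat)" for p
  \<comment> \<open>On every copy of such an \<alpha>, \<Psi> returns the correct bit for the tree
    named by \<open>p\<close>.\<close>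
  define answers where "answers p \<alpha> \<longleftrightarrow> is_tree (tree_of_name p) \<and> Well_order \<alpha> \<and>
    (\<forall>C. ordinal_copy \<alpha> C \<longrightarrow> (\<exists>r. \<Psi> (baire_pair p (copy_name C)) = Some r \<and> r 0 = bit p))"
    for p and \<alpha> :: "nat rel"
  have ex: "\<exists>\<alpha>. answers p \<alpha>" if "is_tree (tree_of_name p)" for p
  proof -
    have in_p: "inrep WF p = Some (tree_of_name p)"
      using that by (simp add: WF_def tree_rep_def)
    then have "tree_of_name p \<in> pdom WF"
      by (auto simp: pdom_def WF_def ran_def)
    then obtain z where z: "z \<in> pdom P" and ans:
      "\<And>q y. outrep P q = Some y \<Longrightarrow> y \<in> sol P z \<Longrightarrow>
         \<exists>r w. \<Psi> (baire_pair p q) = Some r \<and> outrep WF r = Some w \<and> w \<in> sol WF (tree_of_name p)"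
      using red[OF in_p] by blast
    obtain \<alpha> where \<alpha>: "Well_order \<alpha>" "S z \<alpha>"
      using z by (auto simp: pdom_def sol)
    have "\<exists>r. \<Psi> (baire_pair p (copy_name C)) = Some r \<and> r 0 = bit p" if C: "ordinal_copy \<alpha> C" for C
    proof -
      have "C \<in> sol P z" using \<alpha> C sol by blast
      then show ?thesis
        using ans[of "copy_name C" C] copy_rep_copy_name[OF C]
        by (auto simp: out WF_def nat_rep_def bit_def)
    qed
    then show ?thesis using \<alpha> that by (auto simp: answers_def)
  qed
  \<comment> \<open>The full tree shows that some ordinal answers some tree, so a least such ordinal
    exists.\<close>
  have "is_tree (tree_of_name (\<lambda>_. 1))"
    by (simp add: is_tree_def tree_of_name_def set_of_name_def)
  then have "{\<alpha>. \<exists>p. answers p \<alpha>} \<noteq> {}" using ex by blast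
  then obtain \<alpha> where "\<alpha> \<in> {\<alpha>. \<exists>p. answers p \<alpha>}"
    and "\<And>\<beta>. (\<beta>, \<alpha>) \<in> ordLess \<Longrightarrow> \<beta> \<notin> {\<alpha>. \<exists>p. answers p \<alpha>}"
    by (rule wfE_min'[OF wf_ordLess]) blast
  then obtain p where \<alpha>: "answers p \<alpha>"
    and min: "\<And>\<beta> p'. (\<beta>, \<alpha>) \<in> ordLess \<Longrightarrow> \<not> answers p' \<beta>"
    by auto
  have wo: "Well_order \<alpha>" using \<alpha> by (simp add: answers_def)
  let ?C = "(Field \<alpha>, \<alpha> - Id)"
  obtain r where r: "\<Psi> (baire_pair p (copy_name ?C)) = Some r"
    using \<alpha> ordinal_copy_strict[OF wo] by (auto simp: answers_def)
  obtain N where N: "\<And>p' q' r'. \<lbrakk>\<forall>n<N. p' n = p n; \<forall>n<N. q' n = copy_name ?C n;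
      \<Psi> (baire_pair p' q') = Some r'\<rbrakk> \<Longrightarrow> r' 0 = r 0"
    using computable_pair_continuous[OF \<Psi> r] by metis
  \<comment> \<open>Minimality of \<alpha> gives \<alpha> \<le> \<beta> for the ordinal of any other
    tree, so a copy of \<beta> can imitate the chosen copy of \<alpha> up to \<open>N\<close>. The
    bound is \<open>Suc N\<close> because the tree extensions require a positive one.\<close>
  have const: "bit p' = r 0"
    if p': "is_tree (tree_of_name p')" "\<forall>n<Suc N. p' n = p n" for p'
  proof -
    obtain \<beta> where \<beta>: "answers p' \<beta>" using ex p' by blast
    then have "(\<alpha>, \<beta>) \<in> ordLeq"
      using min wo by (meson answers_def not_ordLess_iff_ordLeq)
    then obtain C where C: "ordinal_copy \<beta> C" "\<forall>n<N. copy_name C n = copy_name ?C n"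
      using copy_extends_to_larger_ordinal by blast
    then show ?thesis using \<beta> N p' unfolding answers_def by (metis less_SucI)
  qed
  have tree: "is_tree (tree_of_name p)" using \<alpha> by (simp add: answers_def)
  obtain p0 where "is_tree (tree_of_name p0)" "well_founded_tree (tree_of_name p0)" "\<forall>n<Suc N. p0 n = p n"
    using tree_prefix_extensions(1)[OF tree, of "Suc N"] by blast
  then have "r 0 = 0" using const[of p0] by (simp add: bit_def)
  obtain p1 where "is_tree (tree_of_name p1)" "\<not> well_founded_tree (tree_of_name p1)" "\<forall>n<Suc N. p1 n = p n"
    using tree_prefix_extensions(2)[OF tree, of "Suc N"] by blast
  then have "r 0 = 1" using const[of p1] by (simp add: bit_def)
  then show False using \<open>r 0 = 0\<close> by simp
qed

section \<open>The orders \<open>\<int>\<^sup>\<alpha>\<rat>\<^sup>\<epsilon>\<close>\<close>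

text \<open>Reading \<open>\<rat>\<^sup>0\<close> as a one-point order allows a uniform treatment of both values of \<open>\<epsilon>\<close>.\<close>

definition Q_power :: "nat \<Rightarrow> rat rel" where
  "Q_power \<epsilon> = (if \<epsilon> = 0 then {(0, 0)} else Q_order)"

definition ZQ :: "'a rel \<Rightarrow> nat \<Rightarrow> (('a \<Rightarrow> int) \<times> rat) rel" where
  "ZQ \<alpha> \<epsilon> = order_prod (Z_power \<alpha>) (Q_power \<epsilon>)"

lemma Field_Z_power: "Field (Z_power \<alpha>) = fin_supp (Field \<alpha>)"
  by (auto simp: Field_def Z_power_def)

lemma Field_Q_power: "Field (Q_power \<epsilon>) = (if \<epsilon> = 0 then {0} else UNIV)"
  by (auto simp: Field_def Q_power_def Q_order_def)

lemma order_isomorphic_sym: "order_isomorphic r s \<Longrightarrow> order_isomorphic s r"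
proof -
  assume "order_isomorphic r s"
  then obtain f where f: "bij_betw f (Field r) (Field s)"
    and iff: "\<And>x y. x \<in> Field r \<Longrightarrow> y \<in> Field r \<Longrightarrow> (x, y) \<in> r \<longleftrightarrow> (f x, f y) \<in> s"
    by (auto simp: order_isomorphic_def)
  let ?g = "inv_into (Field r) f"
  have g: "bij_betw ?g (Field s) (Field r)"
    using f by (rule bij_betw_inv_into)
  have "(x, y) \<in> s \<longleftrightarrow> (?g x, ?g y) \<in> r" if "x \<in> Field s" "y \<in> Field s" for x y
    using iff[of "?g x" "?g y"] that g f bij_betwE[OF g] bij_betw_inv_into_right[OF f] by simp
  then show "order_isomorphic s r"
    using g by (auto simp: order_isomorphic_def)
qed

lemma order_isomorphic_trans:
  assumes "order_isomorphic r s" "order_isomorphic s t"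
  shows "order_isomorphic r t"
proof -
  obtain f where f: "bij_betw f (Field r) (Field s)"
    and f_iff: "\<And>x y. x \<in> Field r \<Longrightarrow> y \<in> Field r \<Longrightarrow> (x, y) \<in> r \<longleftrightarrow> (f x, f y) \<in> s"
    using assms(1) by (auto simp: order_isomorphic_def)
  obtain g where g: "bij_betw g (Field s) (Field t)"
    and g_iff: "\<And>x y. x \<in> Field s \<Longrightarrow> y \<in> Field s \<Longrightarrow> (x, y) \<in> s \<longleftrightarrow> (g x, g y) \<in> t"
    using assms(2) by (auto simp: order_isomorphic_def)
  have "(x, y) \<in> r \<longleftrightarrow> ((g \<circ> f) x, (g \<circ> f) y) \<in> t" if "x \<in> Field r" "y \<in> Field r" for x y
    using f_iff g_iff that bij_betwE[OF f] by simp
  then show ?thesis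
    using bij_betw_trans[OF f g] unfolding order_isomorphic_def by blast
qed

lemma linear_order_finite_max:
  assumes "Linear_order \<alpha>" "finite D" "D \<noteq> {}" "D \<subseteq> Field \<alpha>"
  shows "\<exists>u\<in>D. \<forall>y\<in>D. (y, u) \<in> \<alpha>"
  using assms(2-)
proof (induction rule: finite_ne_induct)
  case (singleton x)
  then show ?case using assms(1) by (auto simp: order_on_defs refl_on_def)
next
  case (insert x F)
  then obtain u where u: "u \<in> F" "\<forall>y\<in>F. (y, u) \<in> \<alpha>" by auto
  have "(x, u) \<in> \<alpha> \<or> (u, x) \<in> \<alpha>" "(x, x) \<in> \<alpha>"
    using assms(1) insert.prems u(1) unfolding order_on_defs refl_on_def total_on_def
    by (metis insert_subset subsetD)+
  moreover have "trans \<alpha>" using assms(1) by (auto simp: order_on_defs)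
  moreover have "(y, x) \<in> \<alpha>" if "(u, x) \<in> \<alpha>" "y \<in> F" for y
    using u(2) that \<open>trans \<alpha>\<close> by (metis transD)
  ultimately show ?case using u by auto
qed

lemma fin_supp_top_diff:
  assumes \<alpha>: "Linear_order \<alpha>" and f: "f \<in> fin_supp (Field \<alpha>)" and g: "g \<in> fin_supp (Field \<alpha>)"
    and "f \<noteq> g"
  obtains u where "u \<in> Field \<alpha>" "f u \<noteq> g u" "\<And>y. f y \<noteq> g y \<Longrightarrow> (y, u) \<in> \<alpha>"
proof -
  let ?D = "{y. f y \<noteq> g y}"
  have "?D \<subseteq> {x. f x \<noteq> 0} \<union> {x. g x \<noteq> 0}" by auto
  then have "finite ?D" "?D \<subseteq> Field \<alpha>"
    using f g finite_subset[of ?D] by (auto simp: fin_supp_def)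
  moreover have "?D \<noteq> {}" using \<open>f \<noteq> g\<close> by auto
  ultimately show ?thesis
    using linear_order_finite_max[OF \<alpha>, of ?D] that by blast
qed

lemma fin_supp_outside: "f \<in> fin_supp X \<Longrightarrow> x \<notin> X \<Longrightarrow> f x = 0"
  by (auto simp: fin_supp_def)

lemma Z_power_cases:
  assumes "(f, g) \<in> Z_power \<alpha>" "f \<noteq> g"
  obtains u where "u \<in> Field \<alpha>" "f u < g u" "\<And>y. f y \<noteq> g y \<Longrightarrow> (y, u) \<in> \<alpha>"
proof -
  from assms obtain u where u: "u \<in> Field \<alpha>" "f u < g u" "\<forall>y\<in>Field \<alpha>. f y \<noteq> g y \<longrightarrow> (y, u) \<in> \<alpha>"
    and fg: "f \<in> fin_supp (Field \<alpha>)" "g \<in> fin_supp (Field \<alpha>)"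
    by (auto simp: Z_power_def)
  have "(y, u) \<in> \<alpha>" if "f y \<noteq> g y" for y
    using u(3) fg fin_supp_outside that by (metis (full_types))
  then show ?thesis using that u by blast
qed

lemma Z_powerI:
  assumes "f \<in> fin_supp (Field \<alpha>)" "g \<in> fin_supp (Field \<alpha>)" "u \<in> Field \<alpha>" "f u < g u"
    "\<And>y. f y \<noteq> g y \<Longrightarrow> (y, u) \<in> \<alpha>"
  shows "(f, g) \<in> Z_power \<alpha>"
  using assms by (auto simp: Z_power_def)

text \<open>For transitivity, the greater of the two topmost positions of difference decides how
  \<open>f\<close> and \<open>h\<close> compare. Totality holds because two distinct finitely
  supported functions have a topmost difference.\<close>

lemma Linear_order_Z_power:
  assumes \<alpha>: "Linear_order \<alpha>"
  shows "Linear_order (Z_power \<alpha>)"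
proof -
  have tr: "trans \<alpha>" and as: "antisym \<alpha>" and tot: "total_on (Field \<alpha>) \<alpha>"
    using \<alpha> by (auto simp: order_on_defs)
  have "refl_on (Field (Z_power \<alpha>)) (Z_power \<alpha>)"
    unfolding Field_Z_power by (auto simp: refl_on_def Z_power_def)
  moreover have "trans (Z_power \<alpha>)"
  proof (rule transI)
    fix f g h assume fg: "(f, g) \<in> Z_power \<alpha>" and gh: "(g, h) \<in> Z_power \<alpha>"
    have F: "f \<in> fin_supp (Field \<alpha>)" "h \<in> fin_supp (Field \<alpha>)"
      using fg gh by (auto simp: Z_power_def)
    show "(f, h) \<in> Z_power \<alpha>"
    proof (cases "f = g \<or> g = h")
      case True
      then show ?thesis using fg gh by auto
    next
      case False
      obtain u where u: "u \<in> Field \<alpha>" "f u < g u" "\<And>y. f y \<noteq> g y \<Longrightarrow> (y, u) \<in> \<alpha>"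
        using Z_power_cases[OF fg] False by blast
      obtain v where v: "v \<in> Field \<alpha>" "g v < h v" "\<And>y. g y \<noteq> h y \<Longrightarrow> (y, v) \<in> \<alpha>"
        using Z_power_cases[OF gh] False by blast
      consider "u = v" | "u \<noteq> v" "(u, v) \<in> \<alpha>" | "u \<noteq> v" "(v, u) \<in> \<alpha>"
        using tot u(1) v(1) by (auto simp: total_on_def)
      then show ?thesis
      proof cases
        case 1
        then show ?thesis
          using u v by (intro Z_powerI[OF F u(1)]) (simp, metis)
      next
        case 2
        then have "f v = g v" using u(3) as by (metis antisymD)
        then show ?thesis
          using v u(3) 2 tr by (intro Z_powerI[OF F v(1)]) (simp, metis transD)
      next
        case 3
        then have "g u = h u" using v(3) as by (metis antisymD)
        then show ?thesis
          using u v(3) 3 tr by (intro Z_powerI[OF F u(1)]) (simp, metis transD)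
      qed
    qed
  qed
  moreover have "antisym (Z_power \<alpha>)"
  proof (rule antisymI, rule ccontr)
    fix f g assume fg: "(f, g) \<in> Z_power \<alpha>" and gf: "(g, f) \<in> Z_power \<alpha>" and "f \<noteq> g"
    obtain u where u: "u \<in> Field \<alpha>" "f u < g u" "\<And>y. f y \<noteq> g y \<Longrightarrow> (y, u) \<in> \<alpha>"
      using Z_power_cases[OF fg \<open>f \<noteq> g\<close>] by blast
    obtain v where v: "v \<in> Field \<alpha>" "g v < f v" "\<And>y. g y \<noteq> f y \<Longrightarrow> (y, v) \<in> \<alpha>"
      using Z_power_cases[OF gf] \<open>f \<noteq> g\<close> by metis
    have "u = v" using u(2,3) v(2,3) as by (metis antisymD less_irrefl)
    then show False using u(2) v(2) by simp
  qed
  moreover have "total_on (Field (Z_power \<alpha>)) (Z_power \<alpha>)"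
    unfolding total_on_def Field_Z_power
  proof (intro ballI impI)
    fix f g assume fg: "f \<in> fin_supp (Field \<alpha>)" "g \<in> fin_supp (Field \<alpha>)" "f \<noteq> g"
    obtain u where u: "u \<in> Field \<alpha>" "f u \<noteq> g u" "\<And>y. f y \<noteq> g y \<Longrightarrow> (y, u) \<in> \<alpha>"
      using fin_supp_top_diff[OF \<alpha> fg] by blast
    show "(f, g) \<in> Z_power \<alpha> \<or> (g, f) \<in> Z_power \<alpha>"
    proof (cases "f u < g u")
      case True
      then show ?thesis using Z_powerI[OF fg(1,2) u(1) True u(3)] by blast
    next
      case False
      then have "g u < f u" using u(2) by simp
      from Z_powerI[OF fg(2,1) u(1) this] show ?thesis using u(3) by metis
    qed
  qed
  ultimately show ?thesis by (auto simp: order_on_defs Field_def)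
qed

lemma Field_order_prod_Refl:
  assumes "Refl r"
  shows "Field (order_prod r s) = Field r \<times> Field s"
proof
  show "Field r \<times> Field s \<subseteq> Field (order_prod r s)"
  proof
    fix z assume "z \<in> Field r \<times> Field s"
    then have "(z, z) \<in> order_prod r s"
      using assms by (auto simp: order_prod_def refl_on_def)
    then show "z \<in> Field (order_prod r s)" by (auto simp: Field_def)
  qed
qed (auto simp: order_prod_def Field_def)

lemma Linear_order_order_prod:
  assumes r: "Linear_order r" and s: "Linear_order s"
  shows "Linear_order (order_prod r s)"
proof -
  have F: "Field (order_prod r s) = Field r \<times> Field s"
    using r by (simp add: order_on_defs Field_order_prod_Refl)
  have r': "Refl r" "trans r" "antisym r" "total_on (Field r) r"
    and s': "Refl s" "trans s" "antisym s" "total_on (Field s) s"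
    using r s by (auto simp: order_on_defs)
  have "Refl (order_prod r s)"
    unfolding F using r' by (auto simp: refl_on_def order_prod_def)
  moreover have "trans (order_prod r s)"
  proof (rule transI, clarify)
    fix x x' y y' z z'
    assume 1: "((x, x'), (y, y')) \<in> order_prod r s" and 2: "((y, y'), (z, z')) \<in> order_prod r s"
    have "(x', z') \<in> s \<and> x' \<noteq> z'" if "(x', y') \<in> s" "x' \<noteq> y'" "(y', z') \<in> s"
      using that s'(2,3) by (metis antisymD transD)
    moreover have "(x, z) \<in> r" if "(x, y) \<in> r" "(y, z) \<in> r"
      using that r'(2) by (rule transD[rotated])
    ultimately show "((x, x'), (z, z')) \<in> order_prod r s"
      using 1 2 by (auto simp: order_prod_def)
  qed
  moreover have "antisym (order_prod r s)"
  proof (rule antisymI)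
    fix z z' assume "(z, z') \<in> order_prod r s" "(z', z) \<in> order_prod r s"
    then show "z = z'"
      using antisymD[OF r'(3)] antisymD[OF s'(3)] by (auto simp: order_prod_def)
  qed
  moreover have "Total (order_prod r s)"
    unfolding total_on_def F
  proof (intro ballI impI)
    fix z z' assume "z \<in> Field r \<times> Field s" "z' \<in> Field r \<times> Field s" "z \<noteq> z'"
    then show "(z, z') \<in> order_prod r s \<or> (z', z) \<in> order_prod r s"
      using r'(4) s'(4) unfolding total_on_def order_prod_def
      by (cases z; cases z'; cases "snd z = snd z'") auto
  qed
  ultimately show ?thesis by (auto simp: order_on_defs Field_def)
qed

lemma Linear_order_Q_power: "Linear_order (Q_power \<epsilon>)"
  unfolding order_on_defs Field_Q_power
  by (auto simp: Q_power_def Q_order_def refl_on_def trans_def antisym_def total_on_def)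

lemma Linear_order_ZQ: "Linear_order \<alpha> \<Longrightarrow> Linear_order (ZQ \<alpha> \<epsilon>)"
  unfolding ZQ_def by (intro Linear_order_order_prod Linear_order_Z_power Linear_order_Q_power)

lemma Field_ZQ:
  assumes "Linear_order \<alpha>"
  shows "Field (ZQ \<alpha> \<epsilon>) = fin_supp (Field \<alpha>) \<times> Field (Q_power \<epsilon>)"
  using Linear_order_Z_power[OF assms]
  by (simp add: ZQ_def Field_order_prod_Refl order_on_defs Field_Z_power)

lemma ZQ_iff:
  "((f, p), (g, q)) \<in> ZQ \<alpha> \<epsilon> \<longleftrightarrow> f \<in> fin_supp (Field \<alpha>) \<and> g \<in> fin_supp (Field \<alpha>) \<and>
     p \<in> Field (Q_power \<epsilon>) \<and> q \<in> Field (Q_power \<epsilon>) \<and> (p < q \<or> p = q \<and> (f, g) \<in> Z_power \<alpha>)"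
  by (auto simp: ZQ_def order_prod_def Field_Z_power Field_Q_power Q_power_def Q_order_def)

lemma has_type_ZQ_iff:
  assumes "Linear_order \<alpha>"
  shows "has_type_ZQ r \<alpha> \<epsilon> \<longleftrightarrow> \<epsilon> \<in> {0, 1} \<and> order_isomorphic r (ZQ \<alpha> \<epsilon>)"
proof -
  have "bij_betw (\<lambda>f. (f, 0)) (Field (Z_power \<alpha>)) (Field (ZQ \<alpha> 0))"
    by (auto simp: Field_ZQ[OF assms] Field_Z_power Field_Q_power bij_betw_def inj_on_def)
  moreover have "(f, g) \<in> Z_power \<alpha> \<longleftrightarrow> ((f, 0), (g, 0)) \<in> ZQ \<alpha> 0"
    if "f \<in> Field (Z_power \<alpha>)" "g \<in> Field (Z_power \<alpha>)" for f g
    using that by (simp add: ZQ_iff Field_Z_power Field_Q_power)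
  ultimately have "order_isomorphic (Z_power \<alpha>) (ZQ \<alpha> 0)"
    unfolding order_isomorphic_def by (intro exI[of _ "\<lambda>f. (f, 0)"]) blast
  then have "order_isomorphic r (Z_power \<alpha>) \<longleftrightarrow> order_isomorphic r (ZQ \<alpha> 0)"
    using order_isomorphic_trans order_isomorphic_sym by meson
  moreover have "ZQ \<alpha> 1 = order_prod (Z_power \<alpha>) Q_order"
    by (simp add: ZQ_def Q_power_def)
  ultimately show ?thesis by (auto simp: has_type_ZQ_def)
qed

section \<open>Iterated finite condensation\<close>

definition between :: "'a rel \<Rightarrow> 'a \<Rightarrow> 'a \<Rightarrow> 'a set" where
  "between r x y = {z. (x, z) \<in> r \<and> (z, y) \<in> r \<or> (y, z) \<in> r \<and> (z, x) \<in> r}"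

text \<open>Hausdorff's finite condensation, iterated without forming quotients: for a linear order,
  stage \<open>k\<close> is an equivalence on the original points whose classes are the points of
  the \<open>k\<close>-th condensate. Counting classes that meet an interval replaces counting
  points of the quotient.\<close>

fun condensation :: "'a rel \<Rightarrow> nat \<Rightarrow> 'a rel" where
  "condensation r 0 = Id_on (Field r)"
| "condensation r (Suc k) = {(x, y). x \<in> Field r \<and> y \<in> Field r \<and>
     finite ((\<lambda>z. condensation r k `` {z}) ` between r x y)}"

lemma between_in_Field: "z \<in> between r x y \<Longrightarrow> z \<in> Field r"
  by (auto simp: between_def Field_def)

lemma condensation_in_Field:
  assumes "(x, y) \<in> condensation r k"
  shows "x \<in> Field r" "y \<in> Field r"
  using assms by (cases k; auto)+

text \<open>An isomorphism carries intervals to intervals and, inductively, classes to classes.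
  Taking images is injective on subsets of the field, so the numbers of classes agree.\<close>

lemma condensation_iso:
  assumes f: "bij_betw f (Field r) (Field s)"
    and iff: "\<And>x y. x \<in> Field r \<Longrightarrow> y \<in> Field r \<Longrightarrow> (x, y) \<in> r \<longleftrightarrow> (f x, f y) \<in> s"
    and "x \<in> Field r" "y \<in> Field r"
  shows "(x, y) \<in> condensation r k \<longleftrightarrow> (f x, f y) \<in> condensation s k"
  using assms(3,4)
proof (induction k arbitrary: x y)
  case 0
  then show ?case using f by (auto simp: Id_on_iff bij_betw_def inj_on_def)
next
  case (Suc k)
  have fF: "f ` Field r = Field s" and inj: "inj_on f (Field r)"
    using f by (auto simp: bij_betw_def)
  have btw: "between s (f x) (f y) = f ` between r x y"
  proof (intro equalityI subsetI)
    fix w assume w: "w \<in> between s (f x) (f y)"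
    then have "w \<in> f ` Field r"
      unfolding fF by (rule between_in_Field)
    then obtain z where z: "z \<in> Field r" "w = f z" by blast
    then have "z \<in> between r x y"
      using w iff[OF z(1)] iff[OF _ z(1)] Suc.prems by (simp add: between_def)
    then show "w \<in> f ` between r x y" using z(2) by blast
  next
    fix w assume "w \<in> f ` between r x y"
    then obtain z where z: "z \<in> between r x y" "w = f z" by blast
    have "z \<in> Field r" using z(1) by (rule between_in_Field)
    then show "w \<in> between s (f x) (f y)"
      using z iff[of z] iff[of _ z] Suc.prems by (simp add: between_def)
  qed
  have cls: "condensation s k `` {f z} = f ` (condensation r k `` {z})" if z: "z \<in> between r x y" for z
  proof -
    have zF: "z \<in> Field r" using z by (rule between_in_Field)
    show ?thesis
    proof (intro equalityI subsetI)
      fix w assume w: "w \<in> condensation s k `` {f z}"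
      then have "w \<in> f ` Field r" unfolding fF by (auto dest: condensation_in_Field)
      then obtain v where "v \<in> Field r" "w = f v" by blast
      then show "w \<in> f ` (condensation r k `` {z})"
        using w Suc.IH[OF zF] by auto
    next
      fix w assume "w \<in> f ` (condensation r k `` {z})"
      then obtain v where v: "(z, v) \<in> condensation r k" "w = f v" by auto
      then have "v \<in> Field r" by (auto dest: condensation_in_Field)
      then show "w \<in> condensation s k `` {f z}"
        using v Suc.IH[OF zF] by auto
    qed
  qed
  have "(\<lambda>z. condensation s k `` {z}) ` between s (f x) (f y)
      = (\<lambda>A. f ` A) ` (\<lambda>z. condensation r k `` {z}) ` between r x y"
    unfolding btw image_image using cls by (rule image_cong[OF refl])
  moreover have "inj_on (\<lambda>A. f ` A) ((\<lambda>z. condensation r k `` {z}) ` between r x y)"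
    by (rule inj_on_subset[OF inj_on_image_Pow[OF inj]]) (auto dest: condensation_in_Field)
  ultimately show ?case
    using Suc.prems fF by (auto simp: finite_image_iff)
qed

text \<open>In a linear order the stages increase, so this inclusion says that the next condensation
  merges nothing new.\<close>

definition condensation_stable :: "'a rel \<Rightarrow> nat \<Rightarrow> bool" where
  "condensation_stable r k \<longleftrightarrow> condensation r (Suc k) \<subseteq> condensation r k"

lemma condensation_stable_iso:
  assumes "order_isomorphic r s" "condensation_stable r k"
  shows "condensation_stable s k"
  unfolding condensation_stable_def
proof (rule subrelI)
  obtain f where f: "bij_betw f (Field r) (Field s)"
    and iff: "\<And>x y. x \<in> Field r \<Longrightarrow> y \<in> Field r \<Longrightarrow> (x, y) \<in> r \<longleftrightarrow> (f x, f y) \<in> s"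
    using assms(1) by (auto simp: order_isomorphic_def)
  fix u v assume uv: "(u, v) \<in> condensation s (Suc k)"
  then have "u \<in> Field s" "v \<in> Field s" by auto
  then obtain x y where xy: "x \<in> Field r" "y \<in> Field r" "u = f x" "v = f y"
    using f by (metis bij_betw_def imageE)
  then have "(x, y) \<in> condensation r (Suc k)"
    using uv condensation_iso[OF f iff] by blast
  then have "(x, y) \<in> condensation r k"
    using assms(2) by (auto simp: condensation_stable_def)
  then show "(u, v) \<in> condensation s k"
    using xy condensation_iso[OF f iff] by blast
qed


section \<open>The number of non-trivial condensations of \<open>\<int>\<^sup>\<alpha>\<rat>\<^sup>\<epsilon>\<close>\<close>

definition initial_segment :: "'a rel \<Rightarrow> 'a set \<Rightarrow> bool" where
  "initial_segment \<alpha> I \<longleftrightarrow> I \<subseteq> Field \<alpha> \<and> (\<forall>a\<in>I. \<forall>b. (b, a) \<in> \<alpha> \<longrightarrow> b \<in> I)"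

text \<open>The new element is the least one outside \<open>I\<close>.\<close>

lemma initial_segment_insert:
  assumes \<alpha>: "Well_order \<alpha>" and I: "initial_segment \<alpha> I" and "I \<noteq> Field \<alpha>"
  obtains m where "m \<in> Field \<alpha>" "m \<notin> I" "initial_segment \<alpha> (insert m I)"
proof -
  interpret wo_rel \<alpha> using \<alpha> by (simp add: wo_rel_def)
  let ?B = "Field \<alpha> - I"
  have "?B \<noteq> {}" using assms(2,3) by (auto simp: initial_segment_def)
  then have m: "minim ?B \<in> ?B" by (intro minim_in) auto
  have least: "(minim ?B, b) \<in> \<alpha>" if "b \<in> ?B" for b
    using that by (intro minim_least) auto
  have "b \<in> insert (minim ?B) I" if "(b, minim ?B) \<in> \<alpha>" for b
  proof (rule ccontr)
    assume b: "b \<notin> insert (minim ?B) I"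
    then have "(minim ?B, b) \<in> \<alpha>" using least that by (auto simp: Field_def)
    then show False using b that ANTISYM by (auto dest: antisymD)
  qed
  then have "initial_segment \<alpha> (insert (minim ?B) I)"
    using I m by (auto simp: initial_segment_def)
  then show ?thesis using that m by blast
qed

lemma initial_segment_of_card:
  assumes \<alpha>: "Well_order \<alpha>" and "infinite (Field \<alpha>) \<or> k \<le> card (Field \<alpha>)"
  obtains I where "initial_segment \<alpha> I" "finite I" "card I = k"
proof -
  have "\<exists>I. initial_segment \<alpha> I \<and> finite I \<and> card I = k"
    using assms(2)
  proof (induction k)
    case 0
    then show ?case by (intro exI[of _ "{}"]) (simp add: initial_segment_def)
  next
    case (Suc k)
    then obtain I where I: "initial_segment \<alpha> I" "finite I" "card I = k" by auto
    moreover have "I \<noteq> Field \<alpha>" using I Suc.prems by auto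
    ultimately obtain m where "m \<notin> I" "initial_segment \<alpha> (insert m I)"
      using initial_segment_insert[OF \<alpha>] by blast
    then show ?case using I by (intro exI[of _ "insert m I"]) simp
  qed
  then show ?thesis using that by blast
qed

text \<open>Agreement off an initial segment has convex classes. A difference of \<open>f\<close>
  and \<open>h\<close> outside \<open>I\<close> makes their topmost difference \<open>u\<close> lie
  outside \<open>I\<close>, where \<open>g\<close> equals \<open>f\<close>. The topmost difference
  \<open>v\<close> of \<open>h\<close> and \<open>g\<close> is then at or above \<open>u\<close> and
  also outside \<open>I\<close>, which forces \<open>u = v\<close> and f u < h u < g u = f
  u.\<close>

lemma ZQ_between_agree:
  assumes \<alpha>: "Linear_order \<alpha>" and I: "initial_segment \<alpha> I"
    and xz: "((f, p), (h, r)) \<in> ZQ \<alpha> \<epsilon>" and zy: "((h, r), (g, q)) \<in> ZQ \<alpha> \<epsilon>"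
    and "p = q" and fg: "\<And>x. x \<notin> I \<Longrightarrow> f x = g x"
  shows "r = p" "\<And>x. x \<notin> I \<Longrightarrow> h x = f x"
proof -
  have as: "antisym \<alpha>" using \<alpha> by (auto simp: order_on_defs)
  show "r = p" using xz zy \<open>p = q\<close> by (auto simp: ZQ_iff)
  then have fh: "(f, h) \<in> Z_power \<alpha>" and hg: "(h, g) \<in> Z_power \<alpha>"
    using xz zy \<open>p = q\<close> by (auto simp: ZQ_iff)
  show "h x = f x" if "x \<notin> I" for x
  proof (rule ccontr)
    assume "h x \<noteq> f x"
    then obtain u where u: "u \<in> Field \<alpha>" "f u < h u" "\<And>y. f y \<noteq> h y \<Longrightarrow> (y, u) \<in> \<alpha>"
      using Z_power_cases[OF fh] by metis
    have "u \<notin> I" using u(3)[of x] \<open>h x \<noteq> f x\<close> that I by (auto simp: initial_segment_def)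
    then have "h u \<noteq> g u" using fg u(2) by force
    then obtain v where v: "v \<in> Field \<alpha>" "h v < g v" "\<And>y. h y \<noteq> g y \<Longrightarrow> (y, v) \<in> \<alpha>"
      using Z_power_cases[OF hg] by metis
    have "(u, v) \<in> \<alpha>" using v(3) \<open>h u \<noteq> g u\<close> .
    then have "v \<notin> I" using \<open>u \<notin> I\<close> I by (auto simp: initial_segment_def)
    then have "f v \<noteq> h v" using fg v(2) by force
    then have "u = v" using u(3) \<open>(u, v) \<in> \<alpha>\<close> as by (metis antisymD)
    then show False using u(2) v(2) fg[OF \<open>u \<notin> I\<close>] by simp
  qed
qed

text \<open>Since \<open>m\<close> bounds all positions of difference, either the values at
  \<open>m\<close> coincide or \<open>m\<close> is the topmost difference.\<close>

lemma Z_power_le_at_top: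
  assumes \<alpha>: "Linear_order \<alpha>" and "(f, g) \<in> Z_power \<alpha>" and "\<And>x. f x \<noteq> g x \<Longrightarrow> (x, m) \<in> \<alpha>"
  shows "f m \<le> g m"
proof (cases "f = g")
  case False
  then obtain u where u: "f u < g u" "\<And>y. f y \<noteq> g y \<Longrightarrow> (y, u) \<in> \<alpha>"
    using Z_power_cases[OF assms(2)] by metis
  show ?thesis
  proof (cases "f m = g m")
    case False
    have "u = m"
      using u(2)[OF False] assms(3)[of u] u(1) \<alpha> by (auto simp: order_on_defs dest: antisymD)
    then show ?thesis using u(1) by simp
  qed simp
qed simp

text \<open>For \<open>I\<close> consisting of the first \<open>k\<close> exponents, this turns out
  to be the \<open>k\<close>-th condensation of \<open>ZQ \<alpha> \<epsilon>\<close>.\<close>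

definition agree_off :: "'a set \<Rightarrow> ('a \<Rightarrow> int) \<times> rat \<Rightarrow> ('a \<Rightarrow> int) \<times> rat \<Rightarrow> bool" where
  "agree_off I x y \<longleftrightarrow> snd x = snd y \<and> (\<forall>i. i \<notin> I \<longrightarrow> fst x i = fst y i)"

lemma between_sym: "between r x y = between r y x"
  by (auto simp: between_def)

text \<open>The comparison with \<open>(g, q)\<close> is decided by the rational part or at a
  position above \<open>m\<close>, so raising the value at \<open>m\<close> does not affect it.
  Varying \<open>k\<close> yields infinitely many intermediate points.\<close>

lemma ZQ_shift_between:
  assumes \<alpha>: "Linear_order \<alpha>" and I: "initial_segment \<alpha> I" and m: "m \<in> I"
    and xy: "((f, p), (g, q)) \<in> ZQ \<alpha> \<epsilon>" and n: "\<not> agree_off I (f, p) (g, q)" and "0 \<le> (k::int)"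
  shows "(f(m := f m + k), p) \<in> between (ZQ \<alpha> \<epsilon>) (f, p) (g, q)"
proof -
  have rf: "Refl \<alpha>" and tot: "Total \<alpha>"
    using \<alpha> by (auto simp: order_on_defs)
  have mF: "m \<in> Field \<alpha>" using m I by (auto simp: initial_segment_def)
  let ?f = "f(m := f m + k)"
  have fF: "f \<in> fin_supp (Field \<alpha>)" and gF: "g \<in> fin_supp (Field \<alpha>)"
    and pq: "p \<in> Field (Q_power \<epsilon>)" "q \<in> Field (Q_power \<epsilon>)"
    using xy by (auto simp: ZQ_iff)
  have "{x. ?f x \<noteq> 0} \<subseteq> insert m {x. f x \<noteq> 0}" by auto
  then have F: "?f \<in> fin_supp (Field \<alpha>)"
    using fF mF finite_subset[of "{x. ?f x \<noteq> 0}"] by (auto simp: fin_supp_def)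
  have "(f, ?f) \<in> Z_power \<alpha>"
  proof (cases "k = 0")
    case True
    then show ?thesis using fF by (simp add: Z_power_def)
  next
    case False
    then show ?thesis
      using \<open>0 \<le> k\<close> mF rf by (intro Z_powerI[OF fF F mF]) (auto simp: refl_on_def split: if_splits)
  qed
  then have 1: "((f, p), (?f, p)) \<in> ZQ \<alpha> \<epsilon>"
    using fF F pq by (simp add: ZQ_iff)
  have "((?f, p), (g, q)) \<in> ZQ \<alpha> \<epsilon>"
  proof (cases "p = q")
    case True
    then have fg: "(f, g) \<in> Z_power \<alpha>" using xy by (simp add: ZQ_iff)
    obtain i where i: "i \<notin> I" "f i \<noteq> g i" using n True by (auto simp: agree_off_def)
    then obtain u where u: "u \<in> Field \<alpha>" "f u < g u" "\<And>y. f y \<noteq> g y \<Longrightarrow> (y, u) \<in> \<alpha>"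
      using Z_power_cases[OF fg] by metis
    have uI: "u \<notin> I" using u(3)[OF i(2)] i(1) I by (auto simp: initial_segment_def)
    have "(m, u) \<in> \<alpha>"
      using tot mF u(1) m uI I unfolding total_on_def initial_segment_def by metis
    then have "(?f, g) \<in> Z_power \<alpha>"
      using uI m u by (intro Z_powerI[OF F gF u(1)]) (auto split: if_splits)
    then show ?thesis using True F gF pq by (simp add: ZQ_iff)
  next
    case False
    then show ?thesis using xy F gF pq by (simp add: ZQ_iff)
  qed
  with 1 show ?thesis by (simp add: between_def)
qed

text \<open>Induction removes the greatest element \<open>m\<close> of \<open>I\<close>. Inside one
  class of agreement off \<open>I\<close>, the classes of the previous stage are indexed by the
  integer at \<open>m\<close>, so an interval meets finitely many of them; an interval leaving the
  class contains infinitely many shifts at \<open>m\<close>.\<close>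

lemma condensation_ZQ:
  assumes \<alpha>: "Linear_order \<alpha>"
    and "initial_segment \<alpha> I" "finite I" "card I = k"
  shows "(x, y) \<in> condensation (ZQ \<alpha> \<epsilon>) k \<longleftrightarrow>
    x \<in> Field (ZQ \<alpha> \<epsilon>) \<and> y \<in> Field (ZQ \<alpha> \<epsilon>) \<and> agree_off I x y"
  using assms(2-)
proof (induction k arbitrary: I x y)
  case 0
  then have "agree_off I x y \<longleftrightarrow> x = y" by (auto simp: agree_off_def prod_eq_iff fun_eq_iff)
  then show ?case by (auto simp: Id_on_iff)
next
  case (Suc k)
  let ?Z = "ZQ \<alpha> \<epsilon>"
  note I = \<open>initial_segment \<alpha> I\<close>
  have as: "antisym \<alpha>" using \<alpha> by (auto simp: order_on_defs)
  have lin: "Linear_order ?Z" using \<alpha> by (rule Linear_order_ZQ)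
  have "I \<noteq> {}" "I \<subseteq> Field \<alpha>" using Suc.prems by (auto simp: initial_segment_def)
  then obtain m where m: "m \<in> I" "\<And>i. i \<in> I \<Longrightarrow> (i, m) \<in> \<alpha>"
    using linear_order_finite_max[OF \<alpha> \<open>finite I\<close>] by blast
  define J where "J = I - {m}"
  have "initial_segment \<alpha> J"
    unfolding initial_segment_def
  proof (intro conjI ballI allI impI)
    show "J \<subseteq> Field \<alpha>" using \<open>I \<subseteq> Field \<alpha>\<close> by (auto simp: J_def)
    fix a b assume a: "a \<in> J" and ba: "(b, a) \<in> \<alpha>"
    then have "b \<in> I" using I by (auto simp: initial_segment_def J_def)
    moreover have "b \<noteq> m"
    proof
      assume "b = m"
      then have "a = m" using ba m(2) a as by (auto simp: J_def dest: antisymD)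
      then show False using a by (simp add: J_def)
    qed
    ultimately show "b \<in> J" by (simp add: J_def)
  qed
  moreover have "finite J" "card J = k"
    using Suc.prems m(1) by (auto simp: J_def)
  ultimately have IH: "(x, y) \<in> condensation ?Z k \<longleftrightarrow> x \<in> Field ?Z \<and> y \<in> Field ?Z \<and> agree_off J x y"
    for x y by (rule Suc.IH)
  define cls where "cls z = condensation ?Z k `` {z}" for z
  have cls_eq: "cls z = {w \<in> Field ?Z. z \<in> Field ?Z \<and> agree_off J z w}" for z
    by (auto simp: cls_def IH)
  have ordered: "finite (cls ` between ?Z x y) \<longleftrightarrow> agree_off I x y" if xy: "(x, y) \<in> ?Z" for x y
  proof -
    obtain f p g q where fg: "x = (f, p)" "y = (g, q)" by (cases x; cases y) auto
    show ?thesis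
    proof
      assume *: "agree_off I x y"
      have *: "p = q" "\<And>i. i \<notin> I \<Longrightarrow> f i = g i"
        using * by (auto simp: fg agree_off_def)
      \<comment> \<open>\<open>?c j\<close> is the previous-stage class with value \<open>j\<close>
        at \<open>m\<close>; only values between \<open>f m\<close> and \<open>g m\<close> occur in
        the interval.\<close>
      let ?c = "\<lambda>j. {(h, r) \<in> Field ?Z. agree_off I x (h, r) \<and> h m = j}"
      have "cls z \<in> ?c ` {f m..g m}" if z: "z \<in> between ?Z x y" for z
      proof -
        obtain h r where h: "z = (h, r)" by (cases z)
        have zF: "z \<in> Field ?Z" using z by (rule between_in_Field)
        have "x = y \<Longrightarrow> z = x"
          using z lin by (auto simp: between_def order_on_defs dest: antisymD)
        then have btw: "(x, z) \<in> ?Z \<and> (z, y) \<in> ?Z"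
          using z xy lin unfolding between_def order_on_defs by (auto dest: antisymD transD)
        have r: "r = p" and hf: "\<And>i. i \<notin> I \<Longrightarrow> h i = f i"
          using ZQ_between_agree[OF \<alpha> I, of f p h r \<epsilon> g q] btw * unfolding fg h by auto
        have "(f, h) \<in> Z_power \<alpha>" "(h, g) \<in> Z_power \<alpha>"
          using btw r *(1) by (auto simp: fg h ZQ_iff)
        then have "f m \<le> h m" "h m \<le> g m"
          using hf * m(2) by (metis Z_power_le_at_top[OF \<alpha>])+
        moreover have "cls z = ?c (h m)"
          using zF r hf m(1) by (auto simp: cls_eq h fg agree_off_def J_def)
        ultimately show ?thesis by auto
      qed
      then have "cls ` between ?Z x y \<subseteq> ?c ` {f m..g m}" by blast
      then show "finite (cls ` between ?Z x y)" by (rule finite_subset) simp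
    next
      assume fin: "finite (cls ` between ?Z x y)"
      show "agree_off I x y"
      proof (rule ccontr)
        assume n: "\<not> agree_off I x y"
        let ?z = "\<lambda>n. (f(m := f m + int n), p)"
        have zb: "?z n \<in> between ?Z x y" for n
          using ZQ_shift_between[OF \<alpha> I m(1)] xy n by (simp add: fg)
        have "inj (\<lambda>n. cls (?z n))"
        proof (rule injI)
          fix n n' assume "cls (?z n) = cls (?z n')"
          moreover have "?z n' \<in> cls (?z n')"
            using between_in_Field[OF zb] by (simp add: cls_eq agree_off_def)
          ultimately have "?z n' \<in> cls (?z n)" by simp
          then have "agree_off J (?z n) (?z n')" unfolding cls_eq by blast
          then show "n = n'" by (auto simp: agree_off_def J_def)
        qed
        moreover have "range (\<lambda>n. cls (?z n)) \<subseteq> cls ` between ?Z x y" using zb by blast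
        ultimately show False using fin finite_subset finite_imageD infinite_UNIV_nat by blast
      qed
    qed
  qed
  have sym: "agree_off I x y = agree_off I y x" for x y :: "('a \<Rightarrow> int) \<times> rat"
    by (auto simp: agree_off_def)
  have "finite (cls ` between ?Z x y) \<longleftrightarrow> agree_off I x y" if "x \<in> Field ?Z" "y \<in> Field ?Z"
  proof -
    have "(x, y) \<in> ?Z \<or> (y, x) \<in> ?Z"
      using lin that by (cases "x = y") (auto simp: order_on_defs total_on_def refl_on_def)
    then show ?thesis
      using ordered[of x y] ordered[of y x] between_sym[of ?Z] sym by auto
  qed
  then show ?case by (auto simp: cls_def)
qed

text \<open>If an exponent is left, stage \<open>Suc k\<close> identifies 0 with the unit vector at
  the next exponent, which stage \<open>k\<close> separates. If none is left, stage \<open>k\<close>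
  has collapsed each copy of \<open>\<int>\<^sup>\<alpha>\<close> to a point, and the remaining
  \<open>\<rat>\<^sup>\<epsilon>\<close> is a single point or dense, so nothing more is
  merged.\<close>

lemma condensation_stable_ZQ_iff:
  assumes \<alpha>: "Well_order \<alpha>" and I: "initial_segment \<alpha> I" "finite I" "card I = k"
  shows "condensation_stable (ZQ \<alpha> \<epsilon>) k \<longleftrightarrow> I = Field \<alpha>"
proof
  let ?Z = "ZQ \<alpha> \<epsilon>"
  have lin: "Linear_order \<alpha>" using \<alpha> by (simp add: well_order_on_def)
  show "I = Field \<alpha>" if st: "condensation_stable ?Z k"
  proof (rule ccontr)
    assume "I \<noteq> Field \<alpha>"
    then obtain m where m: "m \<in> Field \<alpha>" "m \<notin> I" "initial_segment \<alpha> (insert m I)"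
      using initial_segment_insert[OF \<alpha> I(1)] by blast
    let ?x = "(\<lambda>_. 0, 0) :: ('a \<Rightarrow> int) \<times> rat" and ?y = "((\<lambda>_. 0)(m := 1), 0) :: ('a \<Rightarrow> int) \<times> rat"
    have F: "?x \<in> Field ?Z" "?y \<in> Field ?Z"
      using m(1) by (auto simp: Field_ZQ[OF lin] fin_supp_def Field_Q_power)
    have "(?x, ?y) \<in> condensation ?Z (Suc k)"
      using condensation_ZQ[OF lin m(3), of "Suc k" ?x ?y \<epsilon>] I m(2) F
      by (simp add: agree_off_def del: condensation.simps)
    then have "(?x, ?y) \<in> condensation ?Z k"
      using st by (auto simp: condensation_stable_def)
    then show False
      using condensation_ZQ[OF lin I] m(2) by (auto simp: agree_off_def)
  qed
  show "condensation_stable ?Z k" if IF: "I = Field \<alpha>"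
    unfolding condensation_stable_def
  proof (rule subrelI)
    fix x y assume xy: "(x, y) \<in> condensation ?Z (Suc k)"
    then have F: "x \<in> Field ?Z" "y \<in> Field ?Z"
      and fin: "finite ((\<lambda>z. condensation ?Z k `` {z}) ` between ?Z x y)" by auto
    \<comment> \<open>Otherwise the rationals strictly between the two coordinates supply infinitely
      many classes in the interval, because stage \<open>k\<close> respects the rational
      coordinate.\<close>
    have "snd x = snd y"
    proof (rule ccontr)
      assume ne: "snd x \<noteq> snd y"
      then have "\<epsilon> \<noteq> 0" using F by (auto simp: Field_ZQ[OF lin] Field_Q_power split: if_splits)
      then have QF: "Field (Q_power \<epsilon>) = UNIV" by (simp add: Field_Q_power)
      define a b where "a = min (snd x) (snd y)" and "b = max (snd x) (snd y)"
      have "a < b" using ne by (auto simp: a_def b_def)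
      let ?z = "\<lambda>r. (fst x, r)"
      have zb: "?z r \<in> between ?Z x y" if "r \<in> {a<..<b}" for r
        using F that unfolding Field_ZQ[OF lin] QF
        by (cases x; cases y; cases "snd x < snd y")
          (auto simp: between_def ZQ_iff QF a_def b_def min_def max_def split: if_splits)
      have "inj_on (\<lambda>r. condensation ?Z k `` {?z r}) {a<..<b}"
      proof (rule inj_onI)
        fix r s assume rs: "r \<in> {a<..<b}" "s \<in> {a<..<b}"
          and eq: "condensation ?Z k `` {?z r} = condensation ?Z k `` {?z s}"
        have "(?z s, ?z s) \<in> condensation ?Z k"
          using between_in_Field[OF zb[OF rs(2)]] condensation_ZQ[OF lin I] by (simp add: agree_off_def)
        then have "(?z r, ?z s) \<in> condensation ?Z k" using eq by blast
        then show "r = s" using condensation_ZQ[OF lin I] by (simp add: agree_off_def)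
      qed
      moreover have "(\<lambda>r. condensation ?Z k `` {?z r}) ` {a<..<b} \<subseteq> (\<lambda>z. condensation ?Z k `` {z}) ` between ?Z x y"
        using zb by blast
      ultimately have "finite {a<..<b}"
        using fin finite_subset finite_imageD by metis
      then show False using \<open>a < b\<close> infinite_Ioo by blast
    qed
    moreover have "fst x \<in> fin_supp (Field \<alpha>)" "fst y \<in> fin_supp (Field \<alpha>)"
      using F by (auto simp: Field_ZQ[OF lin])
    ultimately have "agree_off I x y"
      by (simp add: IF agree_off_def fin_supp_outside)
    then show "(x, y) \<in> condensation ?Z k"
      using condensation_ZQ[OF lin I] F by blast
  qed
qed

text \<open>Stage \<open>card (Field \<alpha>)\<close> is stable on the left. If \<beta> were
  larger, its initial segment of that size would be proper and the same stage unstable on the right.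
  Allowing \<epsilon> and \<delta> to differ rules out that the other form of the order type admits
  another finite exponent.\<close>

lemma ZQ_exponent_card_unique:
  assumes \<alpha>: "Well_order \<alpha>" "finite (Field \<alpha>)" and \<beta>: "Well_order \<beta>"
    and iso: "order_isomorphic (ZQ \<alpha> \<epsilon>) (ZQ \<beta> \<delta>)"
  shows "finite (Field \<beta>)" "card (Field \<beta>) = card (Field \<alpha>)"
proof -
  have upper: "finite (Field \<beta>) \<and> card (Field \<beta>) \<le> card (Field \<alpha>)"
    if \<alpha>: "Well_order \<alpha>" "finite (Field \<alpha>)" and \<beta>: "Well_order \<beta>"
      and iso: "order_isomorphic (ZQ \<alpha> \<epsilon>) (ZQ \<beta> \<delta>)"
    for \<alpha> :: "'c rel" and \<beta> :: "'d rel" and \<epsilon> \<delta>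
  proof (rule ccontr)
    let ?k = "card (Field \<alpha>)"
    assume "\<not> ?thesis"
    then have big: "infinite (Field \<beta>) \<or> ?k < card (Field \<beta>)" by auto
    then obtain I where I: "initial_segment \<beta> I" "finite I" "card I = ?k"
      using initial_segment_of_card[OF \<beta>, of ?k] by (auto simp: less_imp_le)
    have "initial_segment \<alpha> (Field \<alpha>)" by (auto simp: initial_segment_def Field_def)
    then have "condensation_stable (ZQ \<alpha> \<epsilon>) ?k"
      using condensation_stable_ZQ_iff[OF \<alpha>(1)] \<alpha>(2) by blast
    then have "condensation_stable (ZQ \<beta> \<delta>) ?k"
      using condensation_stable_iso[OF iso] by blast
    then have "I = Field \<beta>"
      using condensation_stable_ZQ_iff[OF \<beta> I] by blast
    then show False using big I by auto
  qed
  show "finite (Field \<beta>)" using upper[OF \<alpha> \<beta> iso] by blast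
  then show "card (Field \<beta>) = card (Field \<alpha>)"
    using upper[OF \<alpha> \<beta> iso] upper[OF \<beta> _ \<alpha>(1) order_isomorphic_sym[OF iso]] by force
qed

section \<open>Names of countable ordered abelian groups\<close>

text \<open>The number \<open>n\<close> stands for \<open>e n\<close>, so the universe is always all
  of the natural numbers and two such names can differ only in the tables for operation and
  order.\<close>

definition linear_ogroup_name :: "(nat \<Rightarrow> 'a::plus) \<Rightarrow> 'a rel \<Rightarrow> baire" where
  "linear_ogroup_name e r = baire_pair (\<lambda>_. 1)
     (baire_pair (\<lambda>n. case prod_decode n of (a, b) \<Rightarrow> inv_into UNIV e (e a + e b))
       (\<lambda>n. case prod_decode n of (a, b) \<Rightarrow> of_bool ((e a, e b) \<in> r)))"

lemma ogroup_of_linear_ogroup_name: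
  "carrier (ogroup_of_name (linear_ogroup_name e r)) = UNIV"
  "a \<otimes>\<^bsub>ogroup_of_name (linear_ogroup_name e r)\<^esub> b = inv_into UNIV e (e a + e b)"
  "le_rel (ogroup_of_name (linear_ogroup_name e r)) = {(a, b). (e a, e b) \<in> r}"
  "\<one>\<^bsub>ogroup_of_name (linear_ogroup_name e r)\<^esub>
     = (THE u. \<forall>a. inv_into UNIV e (e u + e a) = a \<and> inv_into UNIV e (e a + e u) = a)"
  by (auto simp: ogroup_of_name_def linear_ogroup_name_def Let_def set_of_name_def rel_of_name_def)

lemma ordered_group_linear_ogroup_name:
  fixes r :: "'a::ab_group_add rel"
  assumes e: "bij_betw e UNIV (Field r)" and lin: "Linear_order r"
    and zero: "0 \<in> Field r" and add: "\<And>x y. x \<in> Field r \<Longrightarrow> y \<in> Field r \<Longrightarrow> x + y \<in> Field r"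
    and minus: "\<And>x. x \<in> Field r \<Longrightarrow> - x \<in> Field r"
    and mono: "\<And>x y z. (x, y) \<in> r \<Longrightarrow> z \<in> Field r \<Longrightarrow> (x + z, y + z) \<in> r"
  shows "ordered_group (ogroup_of_name (linear_ogroup_name e r))"
proof -
  let ?G = "ogroup_of_name (linear_ogroup_name e r)"
  have eF: "e a \<in> Field r" for a using e by (auto simp: bij_betw_def)
  have inv_e: "inv_into UNIV e (e a) = a" for a using e by (simp add: bij_betw_def)
  have e_inv: "e (inv_into UNIV e x) = x" if "x \<in> Field r" for x
    using e that by (auto simp: bij_betw_def f_inv_into_f)
  have e_add: "e (inv_into UNIV e (e a + e b)) = e a + e b" for a b
    using add eF e_inv by blast
  have e_inj: "e a = e b \<longleftrightarrow> a = b" for a b using inv_e by metis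
  have one: "\<one>\<^bsub>?G\<^esub> = inv_into UNIV e 0"
    unfolding ogroup_of_linear_ogroup_name
  proof (rule the_equality)
    show "\<forall>a. inv_into UNIV e (e (inv_into UNIV e 0) + e a) = a \<and> inv_into UNIV e (e a + e (inv_into UNIV e 0)) = a"
      by (simp add: e_inv zero inv_e)
    fix u assume u: "\<forall>a. inv_into UNIV e (e u + e a) = a \<and> inv_into UNIV e (e a + e u) = a"
    then have "e u + e u = e u" using e_add by metis
    then have "e u = 0" by simp
    then show "u = inv_into UNIV e 0" using inv_e[of u] by simp
  qed
  have "group ?G"
  proof (rule groupI)
    fix x
    have "inv_into UNIV e (- e x) \<otimes>\<^bsub>?G\<^esub> x = \<one>\<^bsub>?G\<^esub>"
      unfolding one ogroup_of_linear_ogroup_name(2) using minus eF e_inv by simp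
    then show "\<exists>y\<in>carrier ?G. y \<otimes>\<^bsub>?G\<^esub> x = \<one>\<^bsub>?G\<^esub>"
      unfolding ogroup_of_linear_ogroup_name(1) by blast
  qed (simp_all add: one ogroup_of_linear_ogroup_name(1,2) e_add e_inv zero inv_e add.assoc)
  moreover have "linear_order_on UNIV {(a, b). (e a, e b) \<in> r}"
  proof -
    have "Refl r" "trans r" "antisym r" "Total r"
      using lin by (auto simp: order_on_defs)
    then show ?thesis
      using eF e_inj unfolding order_on_defs refl_on_def total_on_def
      by (auto intro!: transI antisymI dest: transD antisymD)
  qed
  ultimately show ?thesis
    using mono eF by (intro ordered_group.intro ordered_group_axioms.intro)
      (auto simp: ogroup_of_linear_ogroup_name(1-3) e_add add.commute)
qed

lemma le_rel_linear_ogroup_name_iso: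
  assumes e: "bij_betw e UNIV (Field r)" and "Refl r"
  shows "order_isomorphic (le_rel (ogroup_of_name (linear_ogroup_name e r))) r"
proof -
  have eF: "e a \<in> Field r" for a using e by (auto simp: bij_betw_def)
  have "(e a, e a) \<in> r" for a using \<open>Refl r\<close> eF by (auto simp: refl_on_def)
  then have "Field {(a, b). (e a, e b) \<in> r} = UNIV" by (auto simp: Field_def)
  then show ?thesis
    using e by (auto simp: order_isomorphic_def ogroup_of_linear_ogroup_name)
qed

lemma linear_ogroup_name_agree:
  assumes prod: "\<And>a b. a < N \<Longrightarrow> b < N \<Longrightarrow> inv_into UNIV e' (e' a + e' b) = inv_into UNIV e (e a + e b)"
    and le: "\<And>a b. a < N \<Longrightarrow> b < N \<Longrightarrow> (e' a, e' b) \<in> r' \<longleftrightarrow> (e a, e b) \<in> r"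
  shows "\<forall>n<N. linear_ogroup_name e' r' n = linear_ogroup_name e r n"
proof -
  have *: "fst (prod_decode n) < N" "snd (prod_decode n) < N" if "n < N" for n
    using that le_prod_encode_1[of "fst (prod_decode n)" "snd (prod_decode n)"]
      le_prod_encode_2[of "snd (prod_decode n)" "fst (prod_decode n)"] by auto
  show ?thesis
    unfolding linear_ogroup_name_def
    by (intro baire_pair_agree allI impI) (auto simp: split_beta * prod le)
qed

text \<open>Removing the finite part leaves countably infinite sets on both sides, and these can be
  matched arbitrarily.\<close>

lemma bij_extending_finite_injection:
  fixes C :: "'a set"
  assumes S: "finite S" and g: "inj_on g S" "g ` S \<subseteq> C" and C: "countable C" "infinite C"
  obtains e :: "nat \<Rightarrow> 'a" where "bij_betw e UNIV C" "\<And>n. n \<in> S \<Longrightarrow> e n = g n"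
proof -
  have inf: "infinite (UNIV - S)" "infinite (C - g ` S)"
    using S C(2) by auto
  have "bij_betw (to_nat_on (UNIV - S)) (UNIV - S) UNIV"
    using inf(1) by (intro to_nat_on_infinite) auto
  moreover have "bij_betw (from_nat_into (C - g ` S)) UNIV (C - g ` S)"
    using inf(2) C(1) by (intro bij_betw_from_nat_into) auto
  ultimately obtain h where h: "bij_betw h (UNIV - S) (C - g ` S)"
    using bij_betw_trans by blast
  let ?e = "\<lambda>n. if n \<in> S then g n else h n"
  have "bij_betw ?e S (g ` S)"
    using g(1) by (auto simp: bij_betw_def inj_on_def)
  moreover have "bij_betw ?e (UNIV - S) (C - g ` S)"
    using h by (rule bij_betw_cong[THEN iffD1, rotated]) auto
  ultimately have "bij_betw ?e (S \<union> (UNIV - S)) (g ` S \<union> (C - g ` S))"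
    by (rule bij_betw_combine) auto
  moreover have "S \<union> (UNIV - S) = UNIV" "g ` S \<union> (C - g ` S) = C" using g(2) by auto
  ultimately show ?thesis using that[of ?e] by simp
qed

section \<open>The groups \<open>\<int>\<^sup>n\<rat>\<^sup>\<epsilon>\<close>\<close>

abbreviation ZnQ :: "nat \<Rightarrow> nat \<Rightarrow> ((nat \<Rightarrow> int) \<times> rat) rel" where
  "ZnQ n \<epsilon> \<equiv> ZQ (natLeq_on n) \<epsilon>"

lemma Linear_order_natLeq_on: "Linear_order (natLeq_on n)"
  using natLeq_on_Well_order[of n] by (simp add: well_order_on_def)

lemma Linear_order_ZnQ: "Linear_order (ZnQ n \<epsilon>)"
  by (intro Linear_order_ZQ Linear_order_natLeq_on)

lemma fin_supp_natLeq_on: "fin_supp (Field (natLeq_on n)) = {f. \<forall>i\<ge>n. f i = 0}"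
proof -
  have "finite {x. f x \<noteq> 0}" if "\<forall>i\<ge>n. f i = 0" for f :: "nat \<Rightarrow> int"
    by (rule finite_subset[of _ "{..<n}"]) (use that in \<open>auto simp: not_less[symmetric]\<close>)
  then have "fin_supp {x. x < n} = {f. \<forall>i\<ge>n. f i = 0}"
    by (auto simp: fin_supp_def not_less[symmetric])
  then show ?thesis
    by (simp add: Field_natLeq_on)
qed

lemma Refl_ZnQ: "Refl (ZnQ n \<epsilon>)"
  using Linear_order_ZnQ[of n \<epsilon>] by (simp add: order_on_defs)

lemma Field_ZnQ: "Field (ZnQ n \<epsilon>) = {f. \<forall>i\<ge>n. f i = 0} \<times> Field (Q_power \<epsilon>)"
  by (simp add: Field_ZQ[OF Linear_order_natLeq_on] fin_supp_natLeq_on)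

lemma Z_power_natLeq_on_iff:
  "(f, g) \<in> Z_power (natLeq_on n) \<longleftrightarrow> (\<forall>i\<ge>n. f i = 0) \<and> (\<forall>i\<ge>n. g i = 0) \<and>
     (f = g \<or> (\<exists>u. f u < g u \<and> (\<forall>i>u. f i = g i)))"
proof -
  note F = fin_supp_natLeq_on[of n]
  have 1: "\<exists>u. f u < g u \<and> (\<forall>i>u. f i = g i)" if "(f, g) \<in> Z_power (natLeq_on n)" "f \<noteq> g"
    using Z_power_cases[OF that] by (metis (mono_tags, lifting) case_prodD leD mem_Collect_eq)
  have 2: "(f, g) \<in> Z_power (natLeq_on n)"
    if fg: "\<forall>i\<ge>n. f i = 0" "\<forall>i\<ge>n. g i = 0" and u: "f u < g u" "\<forall>i>u. f i = g i" for u
  proof (rule Z_powerI[of _ _ _ u])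
    have lt: "i < n" if "f i \<noteq> g i" for i using fg that by (metis not_less)
    then show "u \<in> Field (natLeq_on n)" using u(1) by (auto simp: Field_natLeq_on)
    show "(y, u) \<in> natLeq_on n" if "f y \<noteq> g y" for y
      using lt[OF that] lt[of u] u that by (auto simp: not_less[symmetric])
  qed (use fg u F in auto)
  show ?thesis
    using 1 2 F by (auto simp: Z_power_def)
qed

lemma countable_ZnQ: "countable (Field (ZnQ n \<epsilon>))"
proof -
  have "countable {f :: nat \<Rightarrow> int. \<forall>i\<ge>n. f i = 0}"
  proof (rule countable_subset)
    show "{f :: nat \<Rightarrow> int. \<forall>i\<ge>n. f i = 0} \<subseteq> (\<lambda>xs i. if i < length xs then xs ! i else 0) ` UNIV"
    proof
      fix f :: "nat \<Rightarrow> int" assume "f \<in> {f. \<forall>i\<ge>n. f i = 0}"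
      then have "f = (\<lambda>i. if i < length (map f [0..<n]) then map f [0..<n] ! i else 0)"
        by (auto simp: fun_eq_iff)
      then show "f \<in> (\<lambda>xs i. if i < length xs then xs ! i else 0) ` UNIV" by blast
    qed
  qed simp
  then show ?thesis unfolding Field_ZnQ by (intro countable_SIGMA) auto
qed

lemma infinite_ZnQ: "0 < n \<Longrightarrow> infinite (Field (ZnQ n \<epsilon>))"
proof
  assume "0 < n" and fin: "finite (Field (ZnQ n \<epsilon>))"
  let ?f = "\<lambda>k::nat. (\<lambda>i. if i = (0::nat) then int k else 0, 0 :: rat)"
  have "inj ?f" by (auto simp: inj_def fun_eq_iff)
  moreover have "range ?f \<subseteq> Field (ZnQ n \<epsilon>)"
    using \<open>0 < n\<close> by (auto simp: Field_ZnQ Field_Q_power)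
  ultimately show False using fin finite_subset finite_imageD infinite_UNIV_nat by blast
qed

lemma ZnQ_iff:
  "((f, p), (g, q)) \<in> ZnQ n \<epsilon> \<longleftrightarrow> (f, p) \<in> Field (ZnQ n \<epsilon>) \<and> (g, q) \<in> Field (ZnQ n \<epsilon>) \<and>
     (p < q \<or> p = q \<and> (f = g \<or> (\<exists>u. f u < g u \<and> (\<forall>i>u. f i = g i))))"
  by (auto simp: ZQ_iff Z_power_natLeq_on_iff fin_supp_natLeq_on Field_ZnQ)

lemma ZnQ_Field_add: "x \<in> Field (ZnQ n \<epsilon>) \<Longrightarrow> y \<in> Field (ZnQ n \<epsilon>) \<Longrightarrow> x + y \<in> Field (ZnQ n \<epsilon>)"
  by (auto simp: Field_ZnQ Field_Q_power split: if_splits)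

lemma ZnQ_add_mono:
  assumes "(x, y) \<in> ZnQ n \<epsilon>" "z \<in> Field (ZnQ n \<epsilon>)"
  shows "(x + z, y + z) \<in> ZnQ n \<epsilon>"
proof -
  obtain f p g q h r where xyz: "x = (f, p)" "y = (g, q)" "z = (h, r)"
    by (cases x; cases y; cases z) auto
  have "(f + h, p + r) \<in> Field (ZnQ n \<epsilon>)" "(g + h, q + r) \<in> Field (ZnQ n \<epsilon>)"
    using assms ZnQ_Field_add[of x n \<epsilon> z] ZnQ_Field_add[of y n \<epsilon> z] by (auto simp: xyz ZnQ_iff)
  then show ?thesis using assms by (simp add: xyz ZnQ_iff)
qed

lemma ordered_group_ZnQ:
  assumes "bij_betw e UNIV (Field (ZnQ n \<epsilon>))"
  shows "ordered_group (ogroup_of_name (linear_ogroup_name e (ZnQ n \<epsilon>)))"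
proof (rule ordered_group_linear_ogroup_name[OF assms Linear_order_ZnQ])
  show "0 \<in> Field (ZnQ n \<epsilon>)" "\<And>x. x \<in> Field (ZnQ n \<epsilon>) \<Longrightarrow> - x \<in> Field (ZnQ n \<epsilon>)"
    by (auto simp: Field_ZnQ Field_Q_power zero_prod_def split: if_splits)
qed (use ZnQ_Field_add ZnQ_add_mono in blast)+

text \<open>
  The homomorphism \<open>\<int>\<^sup>n\<^sup>+\<^sup>1\<rat>\<^sup>\<epsilon> \<rightarrow> \<int>\<^sup>n\<rat>\<^sup>\<epsilon>\<close> sending the second unit vector to \<open>N\<close> times the first.
\<close>

definition merge :: "int \<Rightarrow> (nat \<Rightarrow> int) \<times> rat \<Rightarrow> (nat \<Rightarrow> int) \<times> rat" where
  "merge N = (\<lambda>(f, q). (\<lambda>i. if i = 0 then f 0 + N * f 1 else f (Suc i), q))"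

lemma merge_add: "merge N (x + y) = merge N x + merge N y"
  by (cases x; cases y) (auto simp: merge_def fun_eq_iff algebra_simps)

lemma merge_in_ZnQ: "0 < n \<Longrightarrow> x \<in> Field (ZnQ (Suc n) \<epsilon>) \<Longrightarrow> merge N x \<in> Field (ZnQ n \<epsilon>)"
  by (auto simp: Field_ZnQ merge_def)

text \<open>A topmost difference at index 2 or more just moves down by one, and one at index 0 is
  unchanged. At index 1 the integer gap is at least 1, so after multiplication by \<open>N\<close>
  it outweighs the difference at index 0, which is less than \<open>N\<close>.\<close>

lemma merge_strict_mono:
  assumes "0 < n" and xy: "(x, y) \<in> ZnQ (Suc n) \<epsilon>" "x \<noteq> y" and N: "\<bar>fst x 0 - fst y 0\<bar> < N"
  shows "(merge N x, merge N y) \<in> ZnQ n \<epsilon>" "merge N x \<noteq> merge N y"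
proof -
  obtain f p g q where fg: "x = (f, p)" "y = (g, q)" by (cases x; cases y) auto
  define f' g' where "f' = fst (merge N x)" and "g' = fst (merge N y)"
  have "\<exists>u. f' u < g' u \<and> (\<forall>i>u. f' i = g' i)" if pq: "p = q"
  proof -
    obtain u where u: "f u < g u" "\<forall>i>u. f i = g i"
      using xy pq by (auto simp: fg ZnQ_iff)
    consider "u = 0" | "u = 1" | v where "u = Suc (Suc v)"
      by (metis One_nat_def not0_implies_Suc)
    then show ?thesis
    proof cases
      case 1
      then show ?thesis using u by (intro exI[of _ 0]) (simp add: f'_def g'_def fg merge_def)
    next
      case 2
      have "N * 1 \<le> N * (g 1 - f 1)"
        using N u 2 by (intro mult_left_mono) auto
      then have "f 0 + N * f 1 < g 0 + N * g 1"
        using N by (simp add: fg algebra_simps)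
      then show ?thesis using u 2 by (intro exI[of _ 0]) (simp add: f'_def g'_def fg merge_def)
    next
      case 3
      then show ?thesis using u by (intro exI[of _ "Suc v"]) (simp add: f'_def g'_def fg merge_def)
    qed
  qed
  moreover have "p < q \<or> p = q" using xy by (auto simp: fg ZnQ_iff)
  moreover have "merge N x \<in> Field (ZnQ n \<epsilon>)" "merge N y \<in> Field (ZnQ n \<epsilon>)"
    using merge_in_ZnQ[OF assms(1)] xy(1) by (blast intro: FieldI1 FieldI2)+
  moreover have merge_eq: "merge N x = (f', p)" "merge N y = (g', q)"
    by (simp_all add: f'_def g'_def fg merge_def)
  ultimately have "p < q \<or> p = q \<and> (\<exists>u. f' u < g' u \<and> (\<forall>i>u. f' i = g' i))"
    and "(f', p) \<in> Field (ZnQ n \<epsilon>)" "(g', q) \<in> Field (ZnQ n \<epsilon>)"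
    by (blast, simp_all)
  then have "((f', p), (g', q)) \<in> ZnQ n \<epsilon>" "(f', p) \<noteq> (g', q)"
    unfolding ZnQ_iff by (blast, metis less_irrefl prod.inject)
  then show "(merge N x, merge N y) \<in> ZnQ n \<epsilon>" "merge N x \<noteq> merge N y"
    by (simp_all add: merge_eq)
qed

text \<open>Each \<open>merge N\<close> kills the vector (N, -1, 0, ...), so no single one embeds
  the whole group; for a finite set it suffices that \<open>N\<close> exceeds all differences at
  index 0.\<close>

lemma merge_embeds_finite:
  assumes "0 < n" "finite F" "F \<subseteq> Field (ZnQ (Suc n) \<epsilon>)"
  obtains N where "inj_on (merge N) F"
    "\<And>x y. x \<in> F \<Longrightarrow> y \<in> F \<Longrightarrow> (merge N x, merge N y) \<in> ZnQ n \<epsilon> \<longleftrightarrow> (x, y) \<in> ZnQ (Suc n) \<epsilon>"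
proof -
  \<comment> \<open>Two entries at index 0 are each bounded by the sum, so they differ by at most
    twice the sum.\<close>
  define N where "N = 1 + 2 * (\<Sum>x\<in>F. \<bar>fst x 0\<bar>)"
  have N: "\<bar>fst x 0 - fst y 0\<bar> < N" if "x \<in> F" "y \<in> F" for x y
  proof -
    have "\<bar>fst z 0\<bar> \<le> (\<Sum>x\<in>F. \<bar>fst x 0\<bar>)" if "z \<in> F" for z
      using that assms(2) by (intro member_le_sum) auto
    from this[OF that(1)] this[OF that(2)] show ?thesis by (simp add: N_def)
  qed
  note lin = Linear_order_ZnQ[of n \<epsilon>] Linear_order_ZnQ[of "Suc n" \<epsilon>]
  have total: "(x, y) \<in> ZnQ (Suc n) \<epsilon> \<or> (y, x) \<in> ZnQ (Suc n) \<epsilon>" if "x \<in> F" "y \<in> F" for x y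
    using lin(2) subsetD[OF assms(3) that(1)] subsetD[OF assms(3) that(2)]
    by (cases "x = y") (auto simp: order_on_defs total_on_def refl_on_def)
  have inj: "inj_on (merge N) F"
  proof (rule inj_onI, rule ccontr)
    fix x y assume xy: "x \<in> F" "y \<in> F" and eq: "merge N x = merge N y" and "x \<noteq> y"
    consider "(x, y) \<in> ZnQ (Suc n) \<epsilon>" | "(y, x) \<in> ZnQ (Suc n) \<epsilon>" using total[OF xy] by blast
    then show False
    proof cases
      case 1
      from merge_strict_mono(2)[OF assms(1) this \<open>x \<noteq> y\<close> N[OF xy]] eq show False by simp
    next
      case 2
      from merge_strict_mono(2)[OF assms(1) this _ N[OF xy(2,1)]] eq \<open>x \<noteq> y\<close> show False by simp
    qed
  qed
  have refl: "(merge N x, merge N x) \<in> ZnQ n \<epsilon>" if "x \<in> F" for x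
    using Refl_ZnQ[of n \<epsilon>] merge_in_ZnQ[OF assms(1) subsetD[OF assms(3) that]] by (auto simp: refl_on_def)
  have mono: "(merge N x, merge N y) \<in> ZnQ n \<epsilon>" if "x \<in> F" "y \<in> F" "(x, y) \<in> ZnQ (Suc n) \<epsilon>" for x y
    using merge_strict_mono(1)[OF assms(1) that(3) _ N[OF that(1,2)]] refl[OF that(1)] by (cases "x = y") auto
  have "(merge N x, merge N y) \<in> ZnQ n \<epsilon> \<longleftrightarrow> (x, y) \<in> ZnQ (Suc n) \<epsilon>" if xy: "x \<in> F" "y \<in> F" for x y
  proof
    assume *: "(merge N x, merge N y) \<in> ZnQ n \<epsilon>"
    show "(x, y) \<in> ZnQ (Suc n) \<epsilon>"
    proof (rule ccontr)
      assume n: "(x, y) \<notin> ZnQ (Suc n) \<epsilon>"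
      then have "(merge N y, merge N x) \<in> ZnQ n \<epsilon>" using total xy mono by blast
      moreover have "antisym (ZnQ n \<epsilon>)" using lin(1) by (simp add: order_on_defs)
      ultimately have "merge N x = merge N y" using * antisymD by fast
      then have "x = y" using inj xy by (auto dest: inj_onD)
      then show False using n total xy by blast
    qed
  qed (rule mono[OF xy])
  with inj that show ?thesis by blast
qed

text \<open>A prefix of the name records finitely many sums and comparisons. A suitable
  \<open>merge N\<close> preserves them in the smaller group, and the finite labelling so obtained
  is completed to an enumeration.\<close>

lemma ZnQ_name_prefix_extends_down:
  assumes "0 < n" and e: "bij_betw e UNIV (Field (ZnQ (Suc n) \<epsilon>))"
  obtains e' where "bij_betw e' UNIV (Field (ZnQ n \<epsilon>))"
    "\<forall>i<M. linear_ogroup_name e' (ZnQ n \<epsilon>) i = linear_ogroup_name e (ZnQ (Suc n) \<epsilon>) i"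
proof -
  let ?prod = "\<lambda>a b. inv_into UNIV e (e a + e b)"
  \<comment> \<open>The sums are included because the operation table below \<open>M\<close> may
    contain labels beyond \<open>M\<close>, which the new enumeration must also place
    correctly.\<close>
  define S where "S = {..<M} \<union> (\<lambda>(a, b). ?prod a b) ` ({..<M} \<times> {..<M})"
  have fin: "finite S" by (simp add: S_def)
  have eF: "e a \<in> Field (ZnQ (Suc n) \<epsilon>)" for a using e by (auto simp: bij_betw_def)
  have e_prod: "e (?prod a b) = e a + e b" for a b
    using e ZnQ_Field_add[OF eF eF] by (simp add: bij_betw_def f_inv_into_f)
  obtain N where N: "inj_on (merge N) (e ` S)"
    "\<And>x y. x \<in> e ` S \<Longrightarrow> y \<in> e ` S \<Longrightarrow> (merge N x, merge N y) \<in> ZnQ n \<epsilon> \<longleftrightarrow> (x, y) \<in> ZnQ (Suc n) \<epsilon>"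
    by (rule merge_embeds_finite[OF assms(1), of "e ` S"]) (use fin eF in auto)
  have inj: "inj_on (merge N \<circ> e) S"
    using e N(1) by (intro comp_inj_on) (auto simp: bij_betw_def inj_on_def)
  have sub: "(merge N \<circ> e) ` S \<subseteq> Field (ZnQ n \<epsilon>)"
    using merge_in_ZnQ[OF assms(1) eF] by auto
  obtain e' where e': "bij_betw e' UNIV (Field (ZnQ n \<epsilon>))" "\<And>a. a \<in> S \<Longrightarrow> e' a = (merge N \<circ> e) a"
    using bij_extending_finite_injection[OF fin inj sub countable_ZnQ infinite_ZnQ[OF assms(1)]] by blast
  have "\<forall>i<M. linear_ogroup_name e' (ZnQ n \<epsilon>) i = linear_ogroup_name e (ZnQ (Suc n) \<epsilon>) i"
  proof (rule linear_ogroup_name_agree)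
    fix a b assume ab: "a < M" "b < M"
    then have S: "a \<in> S" "b \<in> S" "?prod a b \<in> S" by (auto simp: S_def)
    have "e' a + e' b = e' (?prod a b)"
      using e'(2) S by (simp add: e_prod merge_add)
    then show "inv_into UNIV e' (e' a + e' b) = ?prod a b"
      using e'(1) by (simp add: bij_betw_def)
    show "(e' a, e' b) \<in> ZnQ n \<epsilon> \<longleftrightarrow> (e a, e b) \<in> ZnQ (Suc n) \<epsilon>"
      using e'(2) S N(2) by simp
  qed
  with e'(1) that show ?thesis by blast
qed

lemma ZnQ_enumeration:
  assumes "0 < n"
  obtains e where "bij_betw e (UNIV :: nat set) (Field (ZnQ n \<epsilon>))"
  using bij_betw_from_nat_into[OF countable_ZnQ infinite_ZnQ[OF assms]] that by blast

text \<open>A solution comes with its own exponent \<alpha> and \<delta>; uniqueness of the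
  cardinality of a finite exponent makes it a copy of an order with \<open>n\<close>
  elements.\<close>

lemma OG_alpha_solution_card:
  assumes e: "bij_betw e UNIV (Field (ZnQ n \<epsilon>))"
    and C: "C \<in> sol OG_alpha (ogroup_of_name (linear_ogroup_name e (ZnQ n \<epsilon>)))"
  shows "finite (fst C)" "card (fst C) = n"
proof -
  let ?r = "le_rel (ogroup_of_name (linear_ogroup_name e (ZnQ n \<epsilon>)))"
  obtain \<alpha> :: "nat rel" and \<delta> where \<alpha>: "Well_order \<alpha>" "has_type_ZQ ?r \<alpha> \<delta>" "ordinal_copy \<alpha> C"
    using C by (auto simp: OG_alpha_def)
  have "order_isomorphic ?r (ZnQ n \<epsilon>)"
    using e Refl_ZnQ by (rule le_rel_linear_ogroup_name_iso)
  moreover have "order_isomorphic ?r (ZQ \<alpha> \<delta>)"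
    using \<alpha>(1,2) by (simp add: has_type_ZQ_iff well_order_on_def)
  ultimately have iso: "order_isomorphic (ZnQ n \<epsilon>) (ZQ \<alpha> \<delta>)"
    using order_isomorphic_sym order_isomorphic_trans by meson
  have fin: "finite (Field (natLeq_on n))" and card: "card (Field (natLeq_on n)) = n"
    by (simp_all add: Field_natLeq_on)
  note \<alpha>_card = ZQ_exponent_card_unique[OF natLeq_on_Well_order fin \<alpha>(1) iso]
  obtain h where "bij_betw h (fst C) (Field \<alpha>)"
    using ordinal_copy_bij[of \<alpha> "fst C" "snd C"] \<alpha>(3) by auto
  then show "finite (fst C)" "card (fst C) = n"
    using \<alpha>_card card bij_betw_finite bij_betw_same_card by metis+
qed

lemma has_type_ZnQ:
  assumes "bij_betw e UNIV (Field (ZnQ n \<epsilon>))" "\<epsilon> \<in> {0, 1}"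
  shows "has_type_ZQ (le_rel (ogroup_of_name (linear_ogroup_name e (ZnQ n \<epsilon>)))) (natLeq_on n) \<epsilon>"
  using assms(2) le_rel_linear_ogroup_name_iso[OF assms(1) Refl_ZnQ]
  by (simp add: has_type_ZQ_iff[OF Linear_order_natLeq_on])

section \<open>Computing the ordinal is not reducible to \<open>WF\<close>\<close>

text \<open>Even positions of the output carry the characteristic function of the universe. Each of
  the finitely many entries 1 is fixed by a finite part of \<open>p\<close>, so no extension of a
  long enough prefix, with the same \<open>q\<close>, can withdraw any of these elements.\<close>

lemma finitely_many_elements_commit:
  assumes \<Psi>: "computable \<Psi>" and r: "\<Psi> (baire_pair p q) = Some r" and fin: "finite {k. r (2 * k) = 1}"
  obtains N where "\<And>p' r'. \<lbrakk>\<forall>n<N. p' n = p n; \<Psi> (baire_pair p' q) = Some r'\<rbrakk>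
    \<Longrightarrow> {k. r (2 * k) = 1} \<subseteq> {k. r' (2 * k) = 1}"
proof -
  let ?A = "{k. r (2 * k) = 1}"
  have "\<exists>N. \<forall>p' r'. (\<forall>n<N. p' n = p n) \<longrightarrow> \<Psi> (baire_pair p' q) = Some r' \<longrightarrow> r' (2 * k) = r (2 * k)" for k
  proof -
    obtain N where N: "\<forall>p' q' r'. (\<forall>n<N. p' n = p n) \<longrightarrow> (\<forall>n<N. q' n = q n) \<longrightarrow>
        \<Psi> (baire_pair p' q') = Some r' \<longrightarrow> r' (2 * k) = r (2 * k)"
      using computable_pair_continuous[OF \<Psi> r, of "2 * k"] ..
    show ?thesis
      using N[THEN spec, THEN spec[of _ q]] by (intro exI[of _ N]) simp
  qed
  then obtain N where N: "\<And>k p' r'. \<lbrakk>\<forall>n<N k. p' n = p n; \<Psi> (baire_pair p' q) = Some r'\<rbrakk>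
      \<Longrightarrow> r' (2 * k) = r (2 * k)"
    by metis
  have "?A \<subseteq> {k. r' (2 * k) = 1}"
    if p': "\<forall>n < sum N ?A. p' n = p n" and r': "\<Psi> (baire_pair p' q) = Some r'" for p' r'
  proof
    fix k assume k: "k \<in> ?A"
    then have "N k \<le> sum N ?A" using fin by (intro member_le_sum) auto
    then have "\<forall>n<N k. p' n = p n" using p' by simp
    from N[OF this r'] k show "k \<in> {k. r' (2 * k) = 1}" by simp
  qed
  then show ?thesis using that by blast
qed

text \<open>The problem has to agree with \<open>OG_alpha\<close> only on the test groups for one
  \<epsilon>, which covers the restricted problems as well.\<close>

lemma ordinal_problem_not_le_WF:
  fixes P :: "(nat ogroup, nat set \<times> nat rel) problem"
  assumes rep: "inrep P = ogroup_rep" "outrep P = copy_rep" and "\<epsilon> \<in> {0, 1}"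
    and sol: "\<And>n e. bij_betw e UNIV (Field (ZnQ n \<epsilon>)) \<Longrightarrow>
      sol P (ogroup_of_name (linear_ogroup_name e (ZnQ n \<epsilon>))) =
      sol OG_alpha (ogroup_of_name (linear_ogroup_name e (ZnQ n \<epsilon>)))"
  shows "\<not> P \<le>\<^sub>W WF"
proof
  assume "P \<le>\<^sub>W WF"
  then obtain \<Phi> \<Psi> where \<Psi>: "computable \<Psi>" and red:
    "\<And>p x. inrep P p = Some x \<Longrightarrow> x \<in> pdom P \<Longrightarrow>
       \<exists>p' z. \<Phi> p = Some p' \<and> inrep WF p' = Some z \<and> z \<in> pdom WF \<and>
         (\<forall>q y. outrep WF q = Some y \<and> y \<in> sol WF z \<longrightarrow>
           (\<exists>r w. \<Psi> (baire_pair p q) = Some r \<and> outrep P r = Some w \<and> w \<in> sol P x))"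
    unfolding weihrauch_le_def by blast
  define name where "name n e = linear_ogroup_name e (ZnQ n \<epsilon>)" for n e
  define enum where "enum n e \<longleftrightarrow> bij_betw e (UNIV :: nat set) (Field (ZnQ n \<epsilon>))" for n e
  define elems where "elems r = {k. r (2 * k) = 1}" for r :: baire
  \<comment> \<open>Given the bit \<open>b\<close>, the first \<open>N\<close> entries of the name
    already force \<open>n\<close> elements into every output on an extension.\<close>
  define committed where "committed n e b N \<longleftrightarrow> b \<in> {0, 1::nat} \<and>
    (\<exists>r. \<Psi> (baire_pair (name n e) (\<lambda>_. b)) = Some r \<and> finite (elems r) \<and> card (elems r) = n \<and>
      (\<forall>p' r'. (\<forall>i<N. p' i = name n e i) \<longrightarrow> \<Psi> (baire_pair p' (\<lambda>_. b)) = Some r' \<longrightarrow>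
         elems r \<subseteq> elems r'))" for n e b N
  have ex: "\<exists>b N. committed n e b N" if e: "enum n e" for n e
  proof -
    let ?G = "ogroup_of_name (name n e)"
    have bij: "bij_betw e UNIV (Field (ZnQ n \<epsilon>))" using e by (simp add: enum_def)
    have in_G: "inrep P (name n e) = Some ?G"
      using ordered_group_ZnQ[OF bij] by (simp add: rep ogroup_rep_def name_def)
    have solG: "sol P ?G = sol OG_alpha ?G" using sol[OF bij] by (simp add: name_def)
    have "(Field (natLeq_on n), natLeq_on n - Id) \<in> sol OG_alpha ?G"
      using has_type_ZnQ[OF bij \<open>\<epsilon> \<in> {0, 1}\<close>] ordinal_copy_strict[OF natLeq_on_Well_order[of n]]
        natLeq_on_Well_order[of n] \<open>\<epsilon> \<in> {0, 1}\<close>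
      unfolding OG_alpha_def name_def by auto
    then have "?G \<in> pdom P" using in_G solG by (auto simp: pdom_def ran_def)
    from red[OF in_G this] obtain z where z: "z \<in> pdom WF" and ans:
      "\<And>q y. outrep WF q = Some y \<Longrightarrow> y \<in> sol WF z \<Longrightarrow>
         \<exists>r w. \<Psi> (baire_pair (name n e) q) = Some r \<and> outrep P r = Some w \<and> w \<in> sol P ?G"
      by blast
    \<comment> \<open>\<open>b\<close> is the correct answer for the tree \<open>z\<close>, and a
      constant sequence is used as its name.\<close>
    define b where "b = (if well_founded_tree z then 0 else 1 :: nat)"
    obtain r C where r: "\<Psi> (baire_pair (name n e) (\<lambda>_. b)) = Some r"
      and C: "copy_rep r = Some C" "C \<in> sol OG_alpha ?G"
      using ans[of "\<lambda>_. b" b] by (auto simp: WF_def nat_rep_def b_def rep solG)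
    have "fst C = elems r"
      using C(1) by (auto simp: copy_rep_def copy_of_name_def set_of_name_def baire_fst_def elems_def split: if_splits)
    then have card: "finite (elems r)" "card (elems r) = n"
      using OG_alpha_solution_card[OF bij, of C] C(2) by (simp_all add: name_def)
    obtain N where "\<And>p' r'. \<lbrakk>\<forall>i<N. p' i = name n e i; \<Psi> (baire_pair p' (\<lambda>_. b)) = Some r'\<rbrakk>
        \<Longrightarrow> elems r \<subseteq> elems r'"
      using finitely_many_elements_commit[OF \<Psi> r] card(1) unfolding elems_def by metis
    then have "committed n e b N"
      unfolding committed_def using r card by (auto simp: b_def)
    then show ?thesis by blast
  qed
  \<comment> \<open>With the same bit, the smaller group would receive all \<open>n\<close> elements
    committed for the larger one, but its copy has only \<open>n'\<close>.\<close>
  have differ: "b \<noteq> b'" if c: "committed n e b N" "committed n' e' b' N'" and "n' < n"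
    and agree: "\<forall>i<N. name n' e' i = name n e i" for n e b N n' e' b' N'
  proof
    assume "b = b'"
    obtain r r' where r: "finite (elems r)" "card (elems r) = n"
      "finite (elems r')" "card (elems r') = n'" "elems r \<subseteq> elems r'"
      using c agree unfolding committed_def \<open>b = b'\<close> by blast
    then have "n \<le> n'" using card_mono by metis
    then show False using \<open>n' < n\<close> by simp
  qed
  have down: "\<exists>e'. enum n e' \<and> (\<forall>i<M. name n e' i = name (Suc n) e i)" if "enum (Suc n) e" "0 < n" for n e M
    using ZnQ_name_prefix_extends_down[OF that(2), of e \<epsilon> M] that(1) unfolding enum_def name_def by blast
  \<comment> \<open>Three groups are taken because there are two bits. The exponents stop at 1,
    since for \<epsilon> = 0 exponent 0 gives a one-point group, which cannot be enumerated
    bijectively by the natural numbers.\<close>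
  obtain e3 where e3: "enum 3 e3" using ZnQ_enumeration[of 3 \<epsilon>] by (auto simp: enum_def)
  then obtain b3 N3 where c3: "committed 3 e3 b3 N3" using ex by blast
  obtain e2 where e2: "enum 2 e2" "\<forall>i<N3. name 2 e2 i = name 3 e3 i"
    using down[of 2 e3 N3] e3 by (auto simp: numeral_3_eq_3)
  then obtain b2 N2 where c2: "committed 2 e2 b2 N2" using ex by blast
  \<comment> \<open>The maximum makes the last name agree with the second up to \<open>N2\<close>
    and, through the second, with the first up to \<open>N3\<close>.\<close>
  obtain e1 where e1: "enum 1 e1" "\<forall>i<max N2 N3. name 1 e1 i = name 2 e2 i"
    using down[of 1 e2 "max N2 N3"] e2 by (auto simp: numeral_2_eq_2)
  then obtain b1 N1 where c1: "committed 1 e1 b1 N1" using ex by blast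
  have "b3 \<noteq> b2" using differ[OF c3 c2] e2(2) by simp
  moreover have "b3 \<noteq> b1" using differ[OF c3 c1] e2(2) e1(2) by simp
  moreover have "b2 \<noteq> b1" using differ[OF c2 c1] e1(2) by simp
  ultimately show False using c1 c2 c3 by (auto simp: committed_def)
qed

section \<open>Incomparability for all three problems\<close>

theorem proposition2p35:
  fixes P :: "(nat ogroup, nat set \<times> nat rel) problem"
  assumes "P \<in> {OG_alpha0, OG_alpha1, OG_alpha}"
  shows "\<not> WF \<le>\<^sub>W P \<and> \<not> P \<le>\<^sub>W WF"
proof -
  \<comment> \<open>All three problems are restrictions of \<open>OG_alpha\<close> to a set
    \<open>D\<close>, with \<open>D = UNIV\<close> for \<open>OG_alpha\<close> itself; \<epsilon> is
    chosen so that the test groups lie in \<open>D\<close>.\<close>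
  define \<epsilon> where "\<epsilon> = (if P = OG_alpha1 then 1 else 0 :: nat)"
  define D where "D = (if P = OG_alpha then UNIV
    else {G :: nat ogroup. \<exists>\<alpha> :: nat rel. Well_order \<alpha> \<and> has_type_ZQ (le_rel G) \<alpha> \<epsilon>})"
  have D: "P = restrict_problem OG_alpha D"
  proof (cases "P = OG_alpha")
    case True
    then show ?thesis by (simp add: D_def restrict_problem_def)
  next
    case False
    then show ?thesis
      using assms by (cases "P = OG_alpha1") (simp_all add: D_def \<epsilon>_def OG_alpha0_def OG_alpha1_def)
  qed
  have ZQ_D: "G \<in> D" if "Well_order \<alpha>" "has_type_ZQ (le_rel G) \<alpha> \<epsilon>" for G and \<alpha> :: "nat rel"
    using that by (auto simp: D_def)
  have reps: "inrep P = ogroup_rep" "outrep P = copy_rep"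
    by (simp_all add: D restrict_problem_def OG_alpha_def)
  have "\<not> WF \<le>\<^sub>W P"
  proof (rule WF_not_le_ordinal_problem[OF reps(2)])
    show "sol P G = {C. \<exists>\<alpha> :: nat rel. Well_order \<alpha> \<and>
        (G \<in> D \<and> (\<exists>\<epsilon>\<in>{0, 1}. has_type_ZQ (le_rel G) \<alpha> \<epsilon>)) \<and> ordinal_copy \<alpha> C}" for G
      by (auto simp: D restrict_problem_def OG_alpha_def)
  qed
  moreover have "\<not> P \<le>\<^sub>W WF"
  proof (rule ordinal_problem_not_le_WF[OF reps])
    show \<epsilon>: "\<epsilon> \<in> {0, 1}" by (simp add: \<epsilon>_def)
    fix n and e :: "nat \<Rightarrow> (nat \<Rightarrow> int) \<times> rat"
    assume "bij_betw e UNIV (Field (ZnQ n \<epsilon>))"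
    then have "ogroup_of_name (linear_ogroup_name e (ZnQ n \<epsilon>)) \<in> D"
      using ZQ_D natLeq_on_Well_order[of n] has_type_ZnQ \<epsilon> by auto
    then show "sol P (ogroup_of_name (linear_ogroup_name e (ZnQ n \<epsilon>))) =
        sol OG_alpha (ogroup_of_name (linear_ogroup_name e (ZnQ n \<epsilon>)))"
      by (simp add: D restrict_problem_def)
  qed
  ultimately show ?thesis by blast
qed

end
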